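(* (Generalization bound for affine targets, $\ell_2$-norm on input weights.) Let $\alpha \geq 1$ be an integer. There exist constants $c(\alpha), C(\alpha) > 0$ depending only on $\alpha$ such that for all integers $d, n \geq 1$ and reals $R,\eta,G>0$ the following holds. Let $\delta = c(\alpha) R \eta$ (which does not grow with $n$), and suppose the data distribution satisfies $\|x\|_2 \leq R$ almost surely and the loss satisfies assumption (L) with constants $G$ and $\delta$. Let $\hat f$ minimize the empirical risk $\hat J$ over $\{f \in \mathcal{F}_1 : \gamma_1(f) \leq \delta\}$. Then for every function $f_\ast(x) = w^\top x + b$ with $\|w\|_2 \leq \eta$ and $|b| \leq R\eta$, $$\mathbb{E}\big[J(\hat f)\big] - J(f_\ast) \leq C(\alpha)\, \frac{G R \eta}{\sqrt{n}},$$ where the expectation is over the $n$ i.i.d. observations.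
   Context: Write $(u)_+^\alpha = \max\{u,0\}^\alpha$. For $x \in \mathbb{R}^d$ let $z = (x^\top, R)^\top \in \mathbb{R}^{d+1}$ and let $\mathcal{V} = \{v \in \mathbb{R}^{d+1} : \|v\|_2 = 1/R\}$. $\mathcal{F}_1$ is the space of functions on $\{\|x\|_2 \leq R\}$ of the form $f(x) = \int_{\mathcal{V}} (v^\top z)_+^\alpha \, d\mu(v)$ with $\mu$ a signed Radon measure on $\mathcal{V}$ of finite total variation; $\gamma_1(f)$ is the infimum of the total variation $|\mu|(\mathcal{V})$ over all such representations. $(x,y)$ is a random pair in $\mathbb{R}^d \times \mathcal{Y}$, $(x_i,y_i)_{i=1}^n$ are i.i.d. copies, $\ell : \mathcal{Y} \times \mathbb{R} \to \mathbb{R}$ is a loss function, $J(f) = \mathbb{E}[\ell(y,f(x))]$ and $\hat J(f) = \frac1n \sum_{i=1}^n \ell(y_i,f(x_i))$. Assumption (L) with constants $G,\delta$: for all $y$, the function $u \mapsto \ell(y,u)$ is $G$-Lipschitz continuous on $\{|u| \leq \sqrt{2}\, \delta\}$, and almost surely $\ell(y,0) \leq G\delta$.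
   Formalization: In (L) the loss is G-Lipschitz on |u| ≤ (√2)^α δ, not √2 δ (same for α = 1): for α ≥ 2 predictors reach (√2)^α δ and the claim as stated fails. The label space Y is fixed before c(α), C(α). Loss and J(f̂) are assumed measurable. *)

theory Defs
  imports "HOL-Probability.Probability"
begin

text \<open>
  The constants of the theorem must not depend on the dimension, so the dimension cannot be a type.
  Points of \<open>\<real>\<^sup>d\<close> are functions in \<open>{..<d} \<rightarrow>\<^sub>E UNIV\<close>, the Euclidean norm is
  \<^const>\<open>L2_set\<close>, and the Borel sigma-algebra is the finite product of copies of
  \<^const>\<open>borel\<close>.
\<close>

definition euclid :: "nat \<Rightarrow> (nat \<Rightarrow> real) measure" where
  "euclid d = (\<Pi>\<^sub>M i\<in>{..<d}. borel)"

definition inner_n :: "nat \<Rightarrow> (nat \<Rightarrow> real) \<Rightarrow> (nat \<Rightarrow> real) \<Rightarrow> real" where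
  "inner_n d u v = (\<Sum>i<d. u i * v i)"

definition norm_n :: "nat \<Rightarrow> (nat \<Rightarrow> real) \<Rightarrow> real" where
  "norm_n d v = L2_set v {..<d}"

definition ball_n :: "nat \<Rightarrow> real \<Rightarrow> (nat \<Rightarrow> real) set" where
  "ball_n d R = {x \<in> {..<d} \<rightarrow>\<^sub>E UNIV. norm_n d x \<le> R}"


subsection \<open>Signed measures\<close>

definition signed_measure :: "'a measure \<Rightarrow> ('a set \<Rightarrow> real) \<Rightarrow> bool" where
  "signed_measure M \<mu> \<longleftrightarrow> \<mu> {} = 0 \<and>
     (\<forall>A :: nat \<Rightarrow> 'a set. range A \<subseteq> sets M \<longrightarrow> disjoint_family A \<longrightarrow>
        (\<lambda>i. \<mu> (A i)) sums \<mu> (\<Union>i. A i))"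

text \<open>Finite partitions are included, since blocks may be empty.\<close>

definition total_variation :: "'a measure \<Rightarrow> ('a set \<Rightarrow> real) \<Rightarrow> 'a set \<Rightarrow> ennreal" where
  "total_variation M \<mu> E =
     (SUP A \<in> {A :: nat \<Rightarrow> 'a set. range A \<subseteq> sets M \<and> disjoint_family A \<and> (\<Union>i. A i) = E}.
        \<Sum>i. ennreal \<bar>\<mu> (A i)\<bar>)"

text \<open>
  Jordan decomposition \<open>\<mu> = (\<bar>\<mu>\<bar> + \<mu>)/2 - (\<bar>\<mu>\<bar> - \<mu>)/2\<close>;
  only meaningful for signed measures of finite total variation.
\<close>

definition pos_variation :: "'a measure \<Rightarrow> ('a set \<Rightarrow> real) \<Rightarrow> 'a measure" where
  "pos_variation M \<mu> = measure_of (space M) (sets M)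
     (\<lambda>E. ennreal ((enn2real (total_variation M \<mu> E) + \<mu> E) / 2))"

definition neg_variation :: "'a measure \<Rightarrow> ('a set \<Rightarrow> real) \<Rightarrow> 'a measure" where
  "neg_variation M \<mu> = measure_of (space M) (sets M)
     (\<lambda>E. ennreal ((enn2real (total_variation M \<mu> E) - \<mu> E) / 2))"

definition signed_integral :: "'a measure \<Rightarrow> ('a set \<Rightarrow> real) \<Rightarrow> ('a \<Rightarrow> real) \<Rightarrow> real" where
  "signed_integral M \<mu> f =
     (\<integral>v. f v \<partial>pos_variation M \<mu>) - (\<integral>v. f v \<partial>neg_variation M \<mu>)"


subsection \<open>The variation space\<close>

text \<open>
  The sphere \<open>\<V>\<close> of radius \<open>1/R\<close> in \<open>\<real>\<^sup>d\<^sup>+\<^sup>1\<close> with its Borel sets. It is a compact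
  metric space, so every finite signed Borel measure on it is Radon.
\<close>

definition weight_sphere :: "nat \<Rightarrow> real \<Rightarrow> (nat \<Rightarrow> real) measure" where
  "weight_sphere d R = restrict_space (euclid (Suc d))
     {v \<in> {..<Suc d} \<rightarrow>\<^sub>E UNIV. norm_n (Suc d) v = 1 / R}"

text \<open>\<open>x(d := R)\<close> is \<open>z = (x, R)\<close>: the coordinates of \<open>x\<close> have indices below \<open>d\<close>.\<close>

definition neuron :: "nat \<Rightarrow> nat \<Rightarrow> real \<Rightarrow> (nat \<Rightarrow> real) \<Rightarrow> (nat \<Rightarrow> real) \<Rightarrow> real" where
  "neuron \<alpha> d R x v = (max (inner_n (Suc d) v (x(d := R))) 0) ^ \<alpha>"

text \<open>
  A function on the ball is an element of \<^const>\<open>extensional\<close>, so that it has no arbitrary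
  (possibly non-measurable) values outside the ball.
\<close>

definition represents ::
    "nat \<Rightarrow> nat \<Rightarrow> real \<Rightarrow> ((nat \<Rightarrow> real) set \<Rightarrow> real) \<Rightarrow> ((nat \<Rightarrow> real) \<Rightarrow> real) \<Rightarrow> bool" where
  "represents \<alpha> d R \<mu> f \<longleftrightarrow>
     signed_measure (weight_sphere d R) \<mu> \<and>
     total_variation (weight_sphere d R) \<mu> (space (weight_sphere d R)) < \<infinity> \<and>
     f \<in> extensional (ball_n d R) \<and>
     (\<forall>x\<in>ball_n d R. f x = signed_integral (weight_sphere d R) \<mu> (neuron \<alpha> d R x))"

definition F1 :: "nat \<Rightarrow> nat \<Rightarrow> real \<Rightarrow> ((nat \<Rightarrow> real) \<Rightarrow> real) set" where
  "F1 \<alpha> d R = {f. \<exists>\<mu>. represents \<alpha> d R \<mu> f}"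

definition gamma1 :: "nat \<Rightarrow> nat \<Rightarrow> real \<Rightarrow> ((nat \<Rightarrow> real) \<Rightarrow> real) \<Rightarrow> ennreal" where
  "gamma1 \<alpha> d R f =
     (INF \<mu> \<in> {\<mu>. represents \<alpha> d R \<mu> f}.
        total_variation (weight_sphere d R) \<mu> (space (weight_sphere d R)))"

definition F1_ball :: "nat \<Rightarrow> nat \<Rightarrow> real \<Rightarrow> real \<Rightarrow> ((nat \<Rightarrow> real) \<Rightarrow> real) set" where
  "F1_ball \<alpha> d R \<delta> = {f \<in> F1 \<alpha> d R. gamma1 \<alpha> d R f \<le> ennreal \<delta>}"


subsection \<open>Risks\<close>

text \<open>
  \<open>D\<close> is the law of \<open>(x, y)\<close>; the \<open>n\<close> i.i.d. observations are a point of the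
  product space \<open>\<Pi>\<^sub>M i\<in>{..<n}. D\<close>.
\<close>

definition risk ::
    "((nat \<Rightarrow> real) \<times> 'y) measure \<Rightarrow> ('y \<Rightarrow> real \<Rightarrow> real) \<Rightarrow> ((nat \<Rightarrow> real) \<Rightarrow> real) \<Rightarrow> real" where
  "risk D loss f = (\<integral>p. loss (snd p) (f (fst p)) \<partial>D)"

definition empirical_risk ::
    "nat \<Rightarrow> (nat \<Rightarrow> (nat \<Rightarrow> real) \<times> 'y) \<Rightarrow> ('y \<Rightarrow> real \<Rightarrow> real) \<Rightarrow> ((nat \<Rightarrow> real) \<Rightarrow> real) \<Rightarrow> real" where
  "empirical_risk n s loss f = (1 / real n) * (\<Sum>i<n. loss (snd (s i)) (f (fst (s i))))"

definition empirical_minimizer ::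
    "nat \<Rightarrow> (nat \<Rightarrow> (nat \<Rightarrow> real) \<times> 'y) \<Rightarrow> ('y \<Rightarrow> real \<Rightarrow> real) \<Rightarrow> ((nat \<Rightarrow> real) \<Rightarrow> real) set \<Rightarrow>
      ((nat \<Rightarrow> real) \<Rightarrow> real) \<Rightarrow> bool" where
  "empirical_minimizer n s loss F f \<longleftrightarrow>
     f \<in> F \<and> (\<forall>g\<in>F. empirical_risk n s loss f \<le> empirical_risk n s loss g)"

text \<open>
  Since \<open>v \<bullet> z \<le> sqrt 2\<close> on the data, the functions with \<open>\<gamma>\<^sub>1 \<le> \<delta>\<close> take values in
  \<open>[- sqrt 2 ^ \<alpha> * \<delta>, sqrt 2 ^ \<alpha> * \<delta>]\<close>, and all of this interval is attained. The paper writes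
  the interval with radius \<open>sqrt 2 * \<delta>\<close>, which is this one for \<open>\<alpha> = 1\<close>; for \<open>\<alpha> \<ge> 2\<close> it
  does not cover the predictions, and as the loss is then unrestricted at some predictions the
  generalization bound fails.
\<close>

definition assumption_L ::
    "nat \<Rightarrow> 'y measure \<Rightarrow> ((nat \<Rightarrow> real) \<times> 'y) measure \<Rightarrow> ('y \<Rightarrow> real \<Rightarrow> real) \<Rightarrow> real \<Rightarrow> real \<Rightarrow> bool" where
  "assumption_L \<alpha> N D loss G \<delta> \<longleftrightarrow>
     (\<forall>y\<in>space N. G-lipschitz_on {u. \<bar>u\<bar> \<le> sqrt 2 ^ \<alpha> * \<delta>} (loss y)) \<and>
     (AE p in D. loss (snd p) 0 \<le> G * \<delta>)"

end

theory Submission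
  imports Defs "HOL-Computational_Algebra.Polynomial"
begin

text \<open>
  Affine functions lie in the variation ball of radius \<open>\<delta> = c R \<eta>\<close>: along the direction of \<open>w\<close>,
  an affine function of \<open>t \<in> [-1, 1]\<close> is a combination of the powers \<open>(1 + r t) ^ \<alpha>\<close> for
  \<open>\<alpha> + 1\<close> values of \<open>r \<in> [0, 1]\<close>, and each of these is a neuron up to a factor depending only
  on \<open>\<alpha>\<close>. So there is no approximation error, and the excess risk is bounded by symmetrization,
  contraction for the loss, passage from the ball to single neurons (a signed integral is at most
  the supremum norm times the total variation), contraction for the activation, and the \<open>l\<^sup>2\<close> bound
  for random signs.

  Suprema over the ball need not be measurable. Its elements are equicontinuous, so it has finite
  nets in the supremum norm, and symmetrization is applied to a net.
\<close>

subsection \<open>Averages over random signs\<close>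

text \<open>The signs are not random variables: \<open>sign_avg\<close> is a finite average, defined
  by recursion on the number of signs, so it asks no measurability of the function averaged, and
  induction splits off one sign at a time. The contraction principle and the norm bound therefore
  carry an offset that collects the terms of signs already fixed.

  The Jordan parts are \<open>measure_of\<close> applied to a formula. The proof avoids showing that
  this formula is countably additive: the estimates use only upper bounds, which hold as well for
  the zero measure that \<open>measure_of\<close> returns otherwise, and exact values are computed
  only for finitely supported measures.

  The cardinality of a net does not enter the complexity bound, so its radius can be chosen of order
  R \<eta> / sqrt n in any dimension. The bound on predictions has to be exact, because the loss is
  Lipschitz only on the matching interval; elsewhere a slack factor 2 in the total variation
  replaces attainment of the infimum in \<open>gamma1\<close>.\<close>

primrec sign_avg :: "nat \<Rightarrow> ((nat \<Rightarrow> real) \<Rightarrow> real) \<Rightarrow> real" where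
  "sign_avg 0 \<Psi> = \<Psi> (\<lambda>_. 0)"
| "sign_avg (Suc n) \<Psi> =
     (sign_avg n (\<lambda>\<epsilon>. \<Psi> (\<epsilon>(n := 1))) + sign_avg n (\<lambda>\<epsilon>. \<Psi> (\<epsilon>(n := - 1)))) / 2"

lemma sign_avg_mono: "(\<And>\<epsilon>. \<Psi> \<epsilon> \<le> \<Phi> \<epsilon>) \<Longrightarrow> sign_avg n \<Psi> \<le> sign_avg n \<Phi>"
proof (induction n arbitrary: \<Psi> \<Phi>)
  case (Suc n)
  have "sign_avg n (\<lambda>\<epsilon>. \<Psi> (\<epsilon>(n := c))) \<le> sign_avg n (\<lambda>\<epsilon>. \<Phi> (\<epsilon>(n := c)))" for c
    by (rule Suc.IH) (rule Suc.prems)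
  from add_mono[OF this[of 1] this[of "- 1"]] show ?case
    by simp
qed simp

lemma sign_avg_add: "sign_avg n (\<lambda>\<epsilon>. \<Psi> \<epsilon> + \<Phi> \<epsilon>) = sign_avg n \<Psi> + sign_avg n \<Phi>"
  by (induction n arbitrary: \<Psi> \<Phi>) (auto simp: field_simps)

lemma sign_avg_cmult: "sign_avg n (\<lambda>\<epsilon>. c * \<Psi> \<epsilon>) = c * sign_avg n \<Psi>"
  by (induction n arbitrary: \<Psi>) (auto simp: field_simps)

lemma sign_avg_uminus: "sign_avg n (\<lambda>\<epsilon>. \<Psi> (\<lambda>i. - \<epsilon> i)) = sign_avg n \<Psi>"
proof (induction n arbitrary: \<Psi>)
  case (Suc n)
  have "(\<lambda>i. - (\<epsilon>(n := c)) i) = (\<lambda>i. - \<epsilon> i)(n := - c)" for \<epsilon> :: "nat \<Rightarrow> real" and c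
    by auto
  then show ?case
    using Suc.IH[of "\<lambda>\<epsilon>. \<Psi> (\<epsilon>(n := 1))"] Suc.IH[of "\<lambda>\<epsilon>. \<Psi> (\<epsilon>(n := - 1))"] by simp
qed simp

text \<open>This is how signs are introduced into an expression that has none: if flipping a sign
  never changes the value, the value at the all-ones vector is already the average. Beyond n the
  vector is 0, as in the base case of \<open>sign_avg\<close>.\<close>

lemma sign_avg_invariant:
  assumes "\<And>\<epsilon> i. i < n \<Longrightarrow> \<Psi> (\<epsilon>(i := 1)) = \<Psi> (\<epsilon>(i := - 1))"
  shows "sign_avg n \<Psi> = \<Psi> (\<lambda>i. if i < n then 1 else 0)"
  using assms
proof (induction n arbitrary: \<Psi>)
  case (Suc n)
  have IH: "sign_avg n (\<lambda>\<epsilon>. \<Psi> (\<epsilon>(n := c))) = \<Psi> ((\<lambda>i. if i < n then 1 else 0)(n := c))" for c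
  proof (rule Suc.IH)
    fix \<epsilon> i assume "i < n"
    then show "\<Psi> (\<epsilon>(i := 1, n := c)) = \<Psi> (\<epsilon>(i := - 1, n := c))"
      using Suc.prems[of i "\<epsilon>(n := c)"] by (metis fun_upd_twist less_SucI less_irrefl)
  qed
  have "(\<lambda>i. if i < n then 1 else 0)(n := 1) = (\<lambda>i. if i < Suc n then 1 else (0 :: real))"
    by (auto simp: less_Suc_eq)
  then show ?case
    by (simp only: sign_avg.simps IH Suc.prems[OF lessI, symmetric]) simp
qed simp

lemma sign_avg_integral:
  assumes "\<And>\<epsilon>. integrable M (\<Psi> \<epsilon>)"
  shows "integrable M (\<lambda>x. sign_avg n (\<lambda>\<epsilon>. \<Psi> \<epsilon> x)) \<and>
    (\<integral>x. sign_avg n (\<lambda>\<epsilon>. \<Psi> \<epsilon> x) \<partial>M) = sign_avg n (\<lambda>\<epsilon>. \<integral>x. \<Psi> \<epsilon> x \<partial>M)"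
  using assms
proof (induction n arbitrary: \<Psi>)
  case (Suc n)
  have "integrable M (\<lambda>x. sign_avg n (\<lambda>\<epsilon>. \<Psi> (\<epsilon>(n := c)) x)) \<and>
    (\<integral>x. sign_avg n (\<lambda>\<epsilon>. \<Psi> (\<epsilon>(n := c)) x) \<partial>M) = sign_avg n (\<lambda>\<epsilon>. \<integral>x. \<Psi> (\<epsilon>(n := c)) x \<partial>M)" for c
    by (rule Suc.IH) (rule Suc.prems)
  then show ?case
    by simp
qed simp

section \<open>Contraction for suprema of signed sums\<close>

lemma cSUP_add_le:
  fixes f g :: "'t \<Rightarrow> real"
  assumes "T \<noteq> {}" and "\<And>t t'. t \<in> T \<Longrightarrow> t' \<in> T \<Longrightarrow> f t + g t' \<le> c"
  shows "(SUP t\<in>T. f t) + (SUP t\<in>T. g t) \<le> c"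
proof -
  have "(SUP t\<in>T. g t) \<le> c - f t" if "t \<in> T" for t
    using assms that by (intro cSUP_least) (auto simp: algebra_simps)
  then have "(SUP t\<in>T. f t) \<le> c - (SUP t\<in>T. g t)"
    using assms(1) by (intro cSUP_least) (auto simp: algebra_simps)
  then show ?thesis
    by simp
qed

text \<open>The suprema are real and thus only conditionally complete; boundedness is what makes
  them upper bounds.\<close>

lemma bounded_signed_sum:
  fixes u :: "'t \<Rightarrow> real" and n :: nat
  assumes "bounded (u ` T)" "\<And>i. i < n \<Longrightarrow> bounded (a i ` T)"
  shows "bounded ((\<lambda>t. u t + (\<Sum>i<n. \<epsilon> i * a i t)) ` T)"
  using assms(2)
proof (induction n)
  case (Suc n)
  have "bounded ((\<lambda>t. \<epsilon> n * a n t) ` T)"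
    using bounded_scaling[OF Suc.prems[of n], of "\<epsilon> n"] by (simp add: image_image)
  from bounded_plus_comp[OF Suc.IH this] Suc.prems show ?case
    by (simp add: add.assoc)
qed (simp add: assms(1))

lemma bdd_signed_sum:
  fixes u :: "'t \<Rightarrow> real" and n :: nat
  assumes "bounded (u ` T)" "\<And>i. i < n \<Longrightarrow> bounded (a i ` T)"
  shows "bdd_above ((\<lambda>t. u t + (\<Sum>i<n. \<epsilon> i * a i t)) ` T)"
  by (intro bounded_imp_bdd_above bounded_signed_sum assms)

text \<open>The contraction principle without absolute values. Fixing the last sign moves its term
  into the offset \<open>u\<close>, and the induction hypothesis replaces the other
  \<open>\<psi> i\<close> by \<open>a i\<close>. For the last term, the two suprema for the signs 1
  and -1 are added and compared at a pair of points.\<close>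

lemma sign_avg_contraction_offset:
  fixes u :: "'t \<Rightarrow> real"
  assumes "T \<noteq> {}" "bounded (u ` T)"
    and "\<And>i. i < n \<Longrightarrow> bounded (a i ` T)" "\<And>i. i < n \<Longrightarrow> bounded (\<psi> i ` T)"
    and "\<And>i t t'. i < n \<Longrightarrow> t \<in> T \<Longrightarrow> t' \<in> T \<Longrightarrow> \<bar>\<psi> i t - \<psi> i t'\<bar> \<le> \<bar>a i t - a i t'\<bar>"
  shows "sign_avg n (\<lambda>\<epsilon>. SUP t\<in>T. u t + (\<Sum>i<n. \<epsilon> i * \<psi> i t)) \<le>
    sign_avg n (\<lambda>\<epsilon>. SUP t\<in>T. u t + (\<Sum>i<n. \<epsilon> i * a i t))"
  using assms(2-)
proof (induction n arbitrary: u)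
  case (Suc n)
  note bnd = Suc.prems(1-3)
  have IH: "sign_avg n (\<lambda>\<epsilon>. SUP t\<in>T. (u t + c * \<psi> n t) + (\<Sum>i<n. \<epsilon> i * \<psi> i t)) \<le>
      sign_avg n (\<lambda>\<epsilon>. SUP t\<in>T. (u t + c * \<psi> n t) + (\<Sum>i<n. \<epsilon> i * a i t))" for c
  proof (rule Suc.IH)
    have "bounded ((\<lambda>t. c * \<psi> n t) ` T)"
      using bounded_scaling[OF bnd(3)[of n], of c] by (simp add: image_image)
    then show "bounded ((\<lambda>t. u t + c * \<psi> n t) ` T)"
      using bnd(1) by (intro bounded_plus_comp)
  qed (use Suc.prems in auto)
  have *: "(SUP t\<in>T. (u t + 1 * \<psi> n t) + (\<Sum>i<n. \<epsilon> i * a i t)) +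
      (SUP t\<in>T. (u t + (- 1) * \<psi> n t) + (\<Sum>i<n. \<epsilon> i * a i t)) \<le>
      (SUP t\<in>T. u t + (\<Sum>i<Suc n. (\<epsilon>(n := 1)) i * a i t)) +
      (SUP t\<in>T. u t + (\<Sum>i<Suc n. (\<epsilon>(n := - 1)) i * a i t))" (is "_ \<le> ?r1 + ?r2") for \<epsilon>
  proof (rule cSUP_add_le[OF assms(1)])
    fix t t' assume t: "t \<in> T" "t' \<in> T"
    have le: "u s + (\<Sum>i<Suc n. (\<epsilon>(n := c)) i * a i s) \<le>
        (SUP t\<in>T. u t + (\<Sum>i<Suc n. (\<epsilon>(n := c)) i * a i t))" if "s \<in> T" for s c
      using that by (rule cSUP_upper) (intro bdd_signed_sum bnd)
    have eq: "u s + (\<Sum>i<Suc n. (\<epsilon>(n := c)) i * a i s) = u s + c * a n s + (\<Sum>i<n. \<epsilon> i * a i s)" for s c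
      by simp
    \<comment> \<open>The right-hand side dominates both the pair (t, t') and the swapped pair (t',
      t); in one of these orders the last terms contribute exactly
      \<open>\<bar>a n t - a n t'\<bar>\<close>.\<close>
    have "\<bar>\<psi> n t - \<psi> n t'\<bar> \<le> \<bar>a n t - a n t'\<bar>"
      using Suc.prems(4)[of n] t by simp
    with le[OF t(1), of 1] le[OF t(1), of "-1"] le[OF t(2), of 1] le[OF t(2), of "-1"]
    show "u t + 1 * \<psi> n t + (\<Sum>i<n. \<epsilon> i * a i t) + (u t' + (- 1) * \<psi> n t' + (\<Sum>i<n. \<epsilon> i * a i t')) \<le> ?r1 + ?r2"
      unfolding eq by linarith
  qed
  have "sign_avg (Suc n) (\<lambda>\<epsilon>. SUP t\<in>T. u t + (\<Sum>i<Suc n. \<epsilon> i * \<psi> i t)) =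
      (sign_avg n (\<lambda>\<epsilon>. SUP t\<in>T. (u t + 1 * \<psi> n t) + (\<Sum>i<n. \<epsilon> i * \<psi> i t)) +
       sign_avg n (\<lambda>\<epsilon>. SUP t\<in>T. (u t + (- 1) * \<psi> n t) + (\<Sum>i<n. \<epsilon> i * \<psi> i t))) / 2"
    by (simp add: algebra_simps)
  also have "\<dots> \<le> (sign_avg n (\<lambda>\<epsilon>. SUP t\<in>T. (u t + 1 * \<psi> n t) + (\<Sum>i<n. \<epsilon> i * a i t)) +
       sign_avg n (\<lambda>\<epsilon>. SUP t\<in>T. (u t + (- 1) * \<psi> n t) + (\<Sum>i<n. \<epsilon> i * a i t))) / 2"
    by (intro divide_right_mono add_mono IH) auto
  also have "\<dots> = sign_avg n (\<lambda>\<epsilon>. (SUP t\<in>T. (u t + 1 * \<psi> n t) + (\<Sum>i<n. \<epsilon> i * a i t)) +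
       (SUP t\<in>T. (u t + (- 1) * \<psi> n t) + (\<Sum>i<n. \<epsilon> i * a i t))) / 2"
    by (simp only: sign_avg_add)
  also have "\<dots> \<le> sign_avg n (\<lambda>\<epsilon>. (SUP t\<in>T. u t + (\<Sum>i<Suc n. (\<epsilon>(n := 1)) i * a i t)) +
      (SUP t\<in>T. u t + (\<Sum>i<Suc n. (\<epsilon>(n := - 1)) i * a i t))) / 2"
    using * by (intro divide_right_mono sign_avg_mono) auto
  also have "\<dots> = sign_avg (Suc n) (\<lambda>\<epsilon>. SUP t\<in>T. u t + (\<Sum>i<Suc n. \<epsilon> i * a i t))"
    by (simp only: sign_avg_add sign_avg.simps)
  finally show ?case .
qed simp

lemma sign_avg_contraction:
  fixes a :: "nat \<Rightarrow> 't \<Rightarrow> real"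
  assumes "T \<noteq> {}"
    and "\<And>i. i < n \<Longrightarrow> bounded (a i ` T)" "\<And>i. i < n \<Longrightarrow> bounded (\<psi> i ` T)"
    and "\<And>i t t'. i < n \<Longrightarrow> t \<in> T \<Longrightarrow> t' \<in> T \<Longrightarrow> \<bar>\<psi> i t - \<psi> i t'\<bar> \<le> \<bar>a i t - a i t'\<bar>"
  shows "sign_avg n (\<lambda>\<epsilon>. SUP t\<in>T. \<Sum>i<n. \<epsilon> i * \<psi> i t) \<le> sign_avg n (\<lambda>\<epsilon>. SUP t\<in>T. \<Sum>i<n. \<epsilon> i * a i t)"
proof -
  have "bounded ((\<lambda>_. 0 :: real) ` T)"
    using assms(1) by (simp add: image_constant_conv)
  from sign_avg_contraction_offset[OF assms(1) this assms(2-)] show ?thesis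
    by simp
qed


subsection \<open>Symmetrization\<close>

lemma cSUP_abs_le:
  fixes f :: "'t \<Rightarrow> real"
  assumes "T \<noteq> {}" "\<And>t. t \<in> T \<Longrightarrow> \<bar>f t\<bar> \<le> c"
  shows "\<bar>SUP t\<in>T. f t\<bar> \<le> c"
  using assms by (intro cSup_abs_le) auto

text \<open>The benefit of a finite net: a supremum of finitely many measurable functions is
  measurable.\<close>

lemma (in prob_space) integrable_SUP_bounded:
  fixes F :: "'t \<Rightarrow> 'a \<Rightarrow> real"
  assumes "finite T" "T \<noteq> {}" "\<And>t. t \<in> T \<Longrightarrow> F t \<in> borel_measurable M"
    and "\<And>t x. t \<in> T \<Longrightarrow> x \<in> space M \<Longrightarrow> \<bar>F t x\<bar> \<le> c"
  shows "integrable M (\<lambda>x. SUP t\<in>T. F t x)"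
proof (rule integrable_const_bound)
  show "AE x in M. norm (SUP t\<in>T. F t x) \<le> c"
    using assms(2,4) by (intro AE_I2) (auto intro!: cSUP_abs_le)
  show "(\<lambda>x. SUP t\<in>T. F t x) \<in> borel_measurable M"
    using assms(1,3) by (intro borel_measurable_cSUP) (auto simp: countable_finite)
qed

lemma measurable_PiM_eval:
  assumes "f \<in> borel_measurable D" "j \<in> J"
  shows "(\<lambda>\<omega>. f (\<omega> j)) \<in> borel_measurable (Pi\<^sub>M J (\<lambda>_. D))"
  by (rule measurable_compose[OF measurable_component_singleton[OF assms(2)] assms(1)])

lemma integral_PiM_eval:
  fixes f :: "'a \<Rightarrow> real"
  assumes "prob_space D" "f \<in> borel_measurable D" "j \<in> J"
  shows "(\<integral>\<omega>. f (\<omega> j) \<partial>Pi\<^sub>M J (\<lambda>_. D)) = (\<integral>p. f p \<partial>D)"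
  using integral_distr[OF measurable_component_singleton[OF assms(3), of "\<lambda>_. D"] assms(2)]
  by (simp add: distr_PiM_component[OF assms(1) assms(3)])

text \<open>The ghost sample argument, scaled by n. The hypothesis bounds the sign average for
  almost every fixed sample, so no integral over samples occurs in it. Sample and ghost sample
  contribute K each.\<close>

lemma symmetrization:
  fixes h :: "'t \<Rightarrow> 'a \<Rightarrow> real" and n :: nat
  assumes D: "prob_space D" and T: "finite T" "T \<noteq> {}"
    and h: "\<And>t. t \<in> T \<Longrightarrow> h t \<in> borel_measurable D"
    and B: "\<And>t p. t \<in> T \<Longrightarrow> p \<in> space D \<Longrightarrow> \<bar>h t p\<bar> \<le> B"
    and K: "AE s in Pi\<^sub>M {..<n} (\<lambda>_. D). sign_avg n (\<lambda>\<epsilon>. SUP t\<in>T. \<Sum>i<n. \<epsilon> i * h t (s i)) \<le> K"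
  shows "(\<integral>s. (SUP t\<in>T. real n * (\<integral>p. h t p \<partial>D) - (\<Sum>i<n. h t (s i))) \<partial>Pi\<^sub>M {..<n} (\<lambda>_. D)) \<le> 2 * K"
proof -
  interpret D: prob_space D by fact
  interpret product_sigma_finite "\<lambda>_ :: nat. D"
    by standard
  \<comment> \<open>Sample, ghost sample, and both as one product over 2 n indices, so that
    exchanging an observation with its ghost is a permutation of coordinates.\<close>
  define P where "P = Pi\<^sub>M {..<n} (\<lambda>_. D)"
  define Q where "Q = Pi\<^sub>M {n..<n+n} (\<lambda>_. D)"
  define W where "W = Pi\<^sub>M {..<n+n} (\<lambda>_. D)"
  interpret P: prob_space P unfolding P_def by (intro prob_space_PiM D)
  interpret Q: prob_space Q unfolding Q_def by (intro prob_space_PiM D)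
  interpret W: prob_space W unfolding W_def by (intro prob_space_PiM D)
  interpret PQ: pair_prob_space P Q ..
  have spP: "s i \<in> space D" if "s \<in> space P" "i < n" for s i
    using that by (auto simp: P_def space_PiM PiE_def Pi_def)
  have spQ: "s (n + i) \<in> space D" if "s \<in> space Q" "i < n" for s i
    using that by (auto simp: Q_def space_PiM PiE_def Pi_def)
  have spW: "s i \<in> space D" if "s \<in> space W" "i < n + n" for s i
    using that by (auto simp: W_def space_PiM PiE_def Pi_def)
  have mP: "(\<lambda>s. h t (s i)) \<in> borel_measurable P" if "t \<in> T" "i < n" for t i
    unfolding P_def using that h by (intro measurable_PiM_eval) auto
  have mQ: "(\<lambda>s. h t (s (n + i))) \<in> borel_measurable Q" if "t \<in> T" "i < n" for t i
    unfolding Q_def using that h by (intro measurable_PiM_eval) auto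
  have mW: "(\<lambda>s. h t (s i)) \<in> borel_measurable W" if "t \<in> T" "i < n + n" for t i
    unfolding W_def using that h by (intro measurable_PiM_eval) auto

  define \<Psi> where "\<Psi> = (\<lambda>\<epsilon> \<omega>. SUP t\<in>T. \<Sum>i<n. \<epsilon> i * (h t (\<omega> (n + i)) - h t (\<omega> i)))"
  define g where "g = (\<lambda>x y. SUP t\<in>T. \<Sum>i<n. h t (y (n + i)) - h t (x i))"
  define u where "u = (\<lambda>s. SUP t\<in>T. real n * (\<integral>p. h t p \<partial>D) - (\<Sum>i<n. h t (s i)))"

  have d_bound: "\<bar>h t p - h t q\<bar> \<le> 2 * B" if "t \<in> T" "p \<in> space D" "q \<in> space D" for t p q
    using B[OF that(1,2)] B[OF that(1,3)] by linarith
  have int_\<Psi>: "integrable W (\<Psi> \<epsilon>)" for \<epsilon>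
    unfolding \<Psi>_def
  proof (rule W.integrable_SUP_bounded[OF T])
    fix t \<omega> assume "t \<in> T" "\<omega> \<in> space W"
    then show "\<bar>\<Sum>i<n. \<epsilon> i * (h t (\<omega> (n + i)) - h t (\<omega> i))\<bar> \<le> (\<Sum>i<n. \<bar>\<epsilon> i\<bar> * (2 * B))"
      by (intro order.trans[OF sum_abs] sum_mono)
        (auto simp: abs_mult intro!: mult_left_mono d_bound spW)
  qed (auto intro!: borel_measurable_sum borel_measurable_times borel_measurable_diff mW)
  have g_bound: "\<bar>\<Sum>i<n. h t (y (n + i)) - h t (x i)\<bar> \<le> (\<Sum>i<n. 2 * B)"
    if "t \<in> T" "x \<in> space P" "y \<in> space Q" for t x y
    using d_bound[OF that(1) spQ[OF that(3)] spP[OF that(2)]]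
    by (intro order.trans[OF sum_abs] sum_mono) auto
  have g_le: "\<bar>g x y\<bar> \<le> (\<Sum>i<n. 2 * B)" if "x \<in> space P" "y \<in> space Q" for x y
    unfolding g_def using T(2) g_bound[OF _ that] by (intro cSUP_abs_le) auto
  have mg: "(\<lambda>(x, y). g x y) \<in> borel_measurable (P \<Otimes>\<^sub>M Q)"
    unfolding g_def split_def
  proof (intro borel_measurable_cSUP borel_measurable_sum borel_measurable_diff)
    fix t i assume "t \<in> T" "i \<in> {..<n}"
    then show "(\<lambda>z. h t (snd z (n + i))) \<in> borel_measurable (P \<Otimes>\<^sub>M Q)"
      "(\<lambda>z. h t (fst z i)) \<in> borel_measurable (P \<Otimes>\<^sub>M Q)"
      using measurable_compose[OF measurable_snd mQ] measurable_compose[OF measurable_fst mP] by auto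
  qed (use T in \<open>auto simp: countable_finite\<close>)
  have int_gy: "integrable Q (g x)" if "x \<in> space P" for x
    unfolding g_def
  proof (rule Q.integrable_SUP_bounded[OF T])
    fix t y assume "t \<in> T" "y \<in> space Q"
    then show "\<bar>\<Sum>i<n. h t (y (n + i)) - h t (x i)\<bar> \<le> (\<Sum>i<n. 2 * B)"
      using that by (intro g_bound)
  qed (auto intro!: borel_measurable_sum borel_measurable_diff mQ)
  have int_g: "integrable P (\<lambda>x. \<integral>y. g x y \<partial>Q)"
  proof (rule P.integrable_const_bound)
    show "(\<lambda>x. \<integral>y. g x y \<partial>Q) \<in> borel_measurable P"
      by (rule Q.borel_measurable_lebesgue_integral[OF mg])
    show "AE x in P. norm (\<integral>y. g x y \<partial>Q) \<le> (\<Sum>i<n. 2 * B)"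
    proof (rule AE_I2)
      fix x assume x: "x \<in> space P"
      have "(\<integral>y. g x y \<partial>Q) \<le> (\<Sum>i<n. 2 * B)"
        using g_le[OF x] by (intro Q.integral_le_const int_gy x AE_I2) (auto simp: abs_le_iff minus_le_iff)
      moreover have "- (\<Sum>i<n. 2 * B) \<le> (\<integral>y. g x y \<partial>Q)"
        using g_le[OF x] by (intro Q.integral_ge_const int_gy x AE_I2) (auto simp: abs_le_iff minus_le_iff)
      ultimately show "norm (\<integral>y. g x y \<partial>Q) \<le> (\<Sum>i<n. 2 * B)"
        by (simp add: abs_le_iff)
    qed
  qed
  have int_u: "integrable P u"
    unfolding u_def
  proof (rule P.integrable_SUP_bounded[OF T])
    fix t s assume ts: "t \<in> T" "s \<in> space P"
    have "integrable D (h t)"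
      using B ts(1) h by (intro D.integrable_const_bound[where B = B] AE_I2) auto
    then have "(\<integral>p. h t p \<partial>D) \<le> B \<and> - B \<le> (\<integral>p. h t p \<partial>D)"
      using B[OF ts(1)] by (auto intro!: D.integral_le_const D.integral_ge_const AE_I2 simp: abs_le_iff) force
    then have "\<bar>real n * (\<integral>p. h t p \<partial>D)\<bar> \<le> real n * B"
      by (auto simp: abs_mult abs_le_iff intro!: mult_left_mono)
    moreover have "\<bar>\<Sum>i<n. h t (s i)\<bar> \<le> (\<Sum>i<n. B)"
      using ts by (intro order.trans[OF sum_abs] sum_mono) (auto intro!: B spP)
    ultimately show "\<bar>real n * (\<integral>p. h t p \<partial>D) - (\<Sum>i<n. h t (s i))\<bar> \<le> real n * B + (\<Sum>i<n. B)"
      by linarith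
  qed (auto intro!: borel_measurable_sum borel_measurable_diff mP)

  \<comment> \<open>The mean of \<open>h t\<close> is the integral over the ghost sample, and a
    supremum of integrals is at most the integral of the supremum.\<close>
  have u_le: "u x \<le> (\<integral>y. g x y \<partial>Q)" if x: "x \<in> space P" for x
    unfolding u_def
  proof (rule cSUP_least[OF T(2)])
    fix t assume t: "t \<in> T"
    have int_h: "integrable Q (\<lambda>y. h t (y (n + i)))" if "i < n" for i
      using t that by (intro Q.integrable_const_bound[where B = B] mQ AE_I2) (auto intro!: B spQ)
    have "real n * (\<integral>p. h t p \<partial>D) - (\<Sum>i<n. h t (x i)) = (\<integral>y. (\<Sum>i<n. h t (y (n + i)) - h t (x i)) \<partial>Q)"
    proof -
      have "(\<integral>y. h t (y (n + i)) \<partial>Q) = (\<integral>p. h t p \<partial>D)" if "i < n" for i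
        unfolding Q_def using that by (intro integral_PiM_eval D h t) auto
      then show ?thesis
        using int_h
        by (subst Bochner_Integration.integral_sum) (auto simp: sum_subtractf Q.prob_space)
    qed
    also have "\<dots> \<le> (\<integral>y. g x y \<partial>Q)"
    proof (rule integral_mono[OF _ int_gy[OF x]])
      show "integrable Q (\<lambda>y. \<Sum>i<n. h t (y (n + i)) - h t (x i))"
        using int_h by (intro Bochner_Integration.integrable_sum Bochner_Integration.integrable_diff) auto
      show "(\<Sum>i<n. h t (y (n + i)) - h t (x i)) \<le> g x y" for y
        unfolding g_def using t T(1) by (intro cSUP_upper) auto
    qed
    finally show "real n * (\<integral>p. h t p \<partial>D) - (\<Sum>i<n. h t (x i)) \<le> (\<integral>y. g x y \<partial>Q)" .
  qed

  define e where "e = (\<lambda>i. if i < n then 1 else 0 :: real)"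
  have "(\<integral>s. u s \<partial>P) \<le> (\<integral>x. (\<integral>y. g x y \<partial>Q) \<partial>P)"
    by (intro integral_mono int_u int_g u_le)
  also have "\<dots> = (\<integral>\<omega>. \<Psi> e \<omega> \<partial>W)"
  proof -
    have un: "{..<n} \<union> {n..<n+n} = {..<n+n}" "{..<n} \<inter> {n..<n+n} = {}"
      by auto
    have "\<Psi> e (merge {..<n} {n..<n+n} (x, y)) = g x y" for x y
      unfolding \<Psi>_def g_def e_def by (intro SUP_cong sum.cong refl) (auto simp: merge_def)
    with product_integral_fold[OF un(2), of "\<Psi> e"] int_\<Psi>[of e] show ?thesis
      unfolding un P_def Q_def W_def by simp
  qed
  also have "\<dots> = sign_avg n (\<lambda>\<epsilon>. \<integral>\<omega>. \<Psi> \<epsilon> \<omega> \<partial>W)"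
  proof -
    have "(\<integral>\<omega>. \<Psi> (\<epsilon>(i := 1)) \<omega> \<partial>W) = (\<integral>\<omega>. \<Psi> (\<epsilon>(i := - 1)) \<omega> \<partial>W)" if i: "i < n" for \<epsilon> i
    proof -
      \<comment> \<open>The transposition of i and n + i preserves the law \<open>W\<close> and
        negates exactly the i-th difference, which amounts to flipping the i-th sign.\<close>
      define \<tau> where "\<tau> = (\<lambda>j. if j = i then n + i else if j = n + i then i else j)"
      have \<tau>: "inj_on \<tau> {..<n+n}" "\<tau> \<in> {..<n+n} \<rightarrow> {..<n+n}"
        using i by (auto simp: \<tau>_def inj_on_def split: if_splits)
      have distr: "distr W W (\<lambda>\<omega>. \<lambda>j\<in>{..<n+n}. \<omega> (\<tau> j)) = W"
        unfolding W_def by (rule distr_PiM_reindex[OF D \<tau>])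
      have ms: "(\<lambda>\<omega>. \<lambda>j\<in>{..<n+n}. \<omega> (\<tau> j)) \<in> measurable W W"
        unfolding W_def using \<tau>(2)
        by (intro measurable_restrict measurable_component_singleton) auto
      have swap: "\<Psi> (\<epsilon>(i := 1)) (\<lambda>j\<in>{..<n+n}. \<omega> (\<tau> j)) = \<Psi> (\<epsilon>(i := - 1)) \<omega>" for \<omega>
        unfolding \<Psi>_def using i by (intro SUP_cong sum.cong refl) (auto simp: \<tau>_def)
      have "(\<integral>\<omega>. \<Psi> (\<epsilon>(i := 1)) \<omega> \<partial>W) = (\<integral>\<omega>. \<Psi> (\<epsilon>(i := 1)) (\<lambda>j\<in>{..<n+n}. \<omega> (\<tau> j)) \<partial>W)"
        using integral_distr[OF ms, of "\<Psi> (\<epsilon>(i := 1))"] int_\<Psi>[of "\<epsilon>(i := 1)"]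
        by (simp add: distr)
      then show ?thesis
        by (simp only: swap)
    qed
    then show ?thesis
      unfolding e_def by (subst sign_avg_invariant) auto
  qed
  also have "\<dots> = (\<integral>\<omega>. sign_avg n (\<lambda>\<epsilon>. \<Psi> \<epsilon> \<omega>) \<partial>W)"
    using sign_avg_integral[of W \<Psi> n] int_\<Psi> by simp
  also have "\<dots> \<le> 2 * K"
  proof (rule W.integral_le_const)
    show "integrable W (\<lambda>\<omega>. sign_avg n (\<lambda>\<epsilon>. \<Psi> \<epsilon> \<omega>))"
      using sign_avg_integral[of W \<Psi> n] int_\<Psi> by simp
    \<comment> \<open>Any n distinct coordinates of \<open>W\<close> again form a sample with law
      \<open>P\<close>, so the almost sure bound transfers to both halves.\<close>
    have AE_W: "AE \<omega> in W. sign_avg n (\<lambda>\<epsilon>. SUP t\<in>T. \<Sum>i<n. \<epsilon> i * h t (\<omega> (\<tau> i))) \<le> K"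
      if \<tau>: "inj_on \<tau> {..<n}" "\<tau> \<in> {..<n} \<rightarrow> {..<n+n}" for \<tau>
    proof -
      have ms: "(\<lambda>\<omega>. \<lambda>j\<in>{..<n}. \<omega> (\<tau> j)) \<in> measurable W P"
        unfolding W_def P_def using \<tau>(2)
        by (intro measurable_restrict measurable_component_singleton) auto
      have "distr W P (\<lambda>\<omega>. \<lambda>j\<in>{..<n}. \<omega> (\<tau> j)) = P"
        unfolding W_def P_def by (rule distr_PiM_reindex[OF D \<tau>])
      then have "AE \<omega> in W. sign_avg n (\<lambda>\<epsilon>. SUP t\<in>T. \<Sum>i<n. \<epsilon> i * h t ((\<lambda>j\<in>{..<n}. \<omega> (\<tau> j)) i)) \<le> K"
        using AE_distrD[OF ms, of "\<lambda>s. sign_avg n (\<lambda>\<epsilon>. SUP t\<in>T. \<Sum>i<n. \<epsilon> i * h t (s i)) \<le> K"] K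
        by (simp only: P_def)
      moreover have "(\<Sum>i<n. \<epsilon> i * h t ((\<lambda>j\<in>{..<n}. \<omega> (\<tau> j)) i)) = (\<Sum>i<n. \<epsilon> i * h t (\<omega> (\<tau> i)))"
        for \<epsilon> t \<omega>
        by (intro sum.cong) auto
      ultimately show ?thesis
        by (simp only:)
    qed
    have "AE \<omega> in W. sign_avg n (\<lambda>\<epsilon>. SUP t\<in>T. \<Sum>i<n. \<epsilon> i * h t (\<omega> (n + i))) \<le> K"
      by (rule AE_W) auto
    moreover have "AE \<omega> in W. sign_avg n (\<lambda>\<epsilon>. SUP t\<in>T. \<Sum>i<n. \<epsilon> i * h t (\<omega> i)) \<le> K"
      by (rule AE_W) auto
    ultimately show "AE \<omega> in W. sign_avg n (\<lambda>\<epsilon>. \<Psi> \<epsilon> \<omega>) \<le> 2 * K"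
    proof eventually_elim
      case (elim \<omega>)
      define \<Phi> where "\<Phi> = (\<lambda>\<epsilon>. SUP t\<in>T. \<Sum>i<n. \<epsilon> i * h t (\<omega> i))"
      \<comment> \<open>Subadditivity of the supremum. The minus sign of the second half is moved
        onto the signs, where \<open>sign_avg_uminus\<close> removes it.\<close>
      have "\<Psi> \<epsilon> \<omega> \<le> (SUP t\<in>T. \<Sum>i<n. \<epsilon> i * h t (\<omega> (n + i))) + \<Phi> (\<lambda>i. - \<epsilon> i)" for \<epsilon>
        unfolding \<Psi>_def
      proof (rule cSUP_least[OF T(2)])
        fix t assume t: "t \<in> T"
        have "(\<Sum>i<n. \<epsilon> i * (h t (\<omega> (n + i)) - h t (\<omega> i))) =
            (\<Sum>i<n. \<epsilon> i * h t (\<omega> (n + i))) + (\<Sum>i<n. - \<epsilon> i * h t (\<omega> i))"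
          by (simp add: sum_subtractf right_diff_distrib sum_negf)
        also have "\<dots> \<le> (SUP t\<in>T. \<Sum>i<n. \<epsilon> i * h t (\<omega> (n + i))) + \<Phi> (\<lambda>i. - \<epsilon> i)"
          unfolding \<Phi>_def using t T(1) by (intro add_mono cSUP_upper) auto
        finally show "(\<Sum>i<n. \<epsilon> i * (h t (\<omega> (n + i)) - h t (\<omega> i))) \<le>
          (SUP t\<in>T. \<Sum>i<n. \<epsilon> i * h t (\<omega> (n + i))) + \<Phi> (\<lambda>i. - \<epsilon> i)" .
      qed
      then have "sign_avg n (\<lambda>\<epsilon>. \<Psi> \<epsilon> \<omega>) \<le>
          sign_avg n (\<lambda>\<epsilon>. (SUP t\<in>T. \<Sum>i<n. \<epsilon> i * h t (\<omega> (n + i))) + \<Phi> (\<lambda>i. - \<epsilon> i))"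
        by (rule sign_avg_mono)
      also have "\<dots> \<le> K + K"
        unfolding sign_avg_add sign_avg_uminus using elim by (intro add_mono) (auto simp: \<Phi>_def)
      finally show ?case by simp
    qed
  qed
  finally show ?thesis
    unfolding u_def P_def .
qed


subsection \<open>Signed integrals\<close>

text \<open>\<open>measure_of\<close> assigns 0 everywhere if its set function is not a measure, and
  0 to sets outside the sigma-algebra, so the inequality holds in every case.\<close>

lemma emeasure_measure_of_le:
  "emeasure (measure_of (space M) (sets M) F) E \<le> F E"
  by (simp add: emeasure_measure_of_conv sets.space_closed)

lemma sets_variation [measurable_cong, simp]:
  "sets (pos_variation M \<mu>) = sets M" "sets (neg_variation M \<mu>) = sets M"
  by (simp_all add: pos_variation_def neg_variation_def)

lemma space_variation [simp]:
  "space (pos_variation M \<mu>) = space M" "space (neg_variation M \<mu>) = space M"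
  by (simp_all add: pos_variation_def neg_variation_def)

text \<open>Both set functions have values \<open>ennreal\<close> of a real. This stays finite even
  for infinite total variation, where \<open>enn2real\<close> returns 0.\<close>

lemma finite_measure_variation:
  "finite_measure (pos_variation M \<mu>)" "finite_measure (neg_variation M \<mu>)"
proof -
  have "emeasure (measure_of (space M) (sets M) (\<lambda>E. ennreal (F E))) (space M) \<noteq> \<infinity>" for F
    using emeasure_measure_of_le[of M "\<lambda>E. ennreal (F E)" "space M"] by (auto simp: top_unique)
  then show "finite_measure (pos_variation M \<mu>)" "finite_measure (neg_variation M \<mu>)"
    by (auto intro!: finite_measureI simp: pos_variation_def neg_variation_def)
qed

lemma binaryset_partition:
  assumes "A \<in> sets M" "B \<in> sets M" "A \<inter> B = {}"
  shows "range (binaryset A B) \<subseteq> sets M \<and> disjoint_family (binaryset A B) \<and>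
    (\<Union>i. binaryset A B i) = A \<union> B"
proof -
  from assms(3) have "disjoint_family (binaryset A B)"
    by (auto simp: disjoint_family_on_def binaryset_def)
  then show ?thesis
    using assms(1,2) by (simp add: range_binaryset_eq UN_binaryset_eq)
qed

lemma abs_le_total_variation:
  assumes "signed_measure M \<mu>" "E \<in> sets M"
  shows "ennreal \<bar>\<mu> E\<bar> \<le> total_variation M \<mu> E"
proof -
  have "\<mu> {} = 0"
    using assms(1) by (simp add: signed_measure_def)
  then have *: "(\<Sum>i. ennreal \<bar>\<mu> (binaryset E {} i)\<bar>) = ennreal \<bar>\<mu> E\<bar>"
    by (subst suminf_binaryset_eq) simp_all
  have "binaryset E {} \<in> {A. range A \<subseteq> sets M \<and> disjoint_family A \<and> (\<Union>i. A i) = E}"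
    using binaryset_partition[OF assms(2), of "{}"] by (simp del: UN_simps)
  from SUP_upper[OF this, of "\<lambda>A. \<Sum>i. ennreal \<bar>\<mu> (A i)\<bar>"]
  show ?thesis
    unfolding total_variation_def * .
qed

text \<open>The masses (tv + \<mu>)/2 and (tv - \<mu>)/2 add up to tv. The bound of
  \<open>\<bar>\<mu> (space M)\<bar>\<close> by tv makes both nonnegative, so that
  \<open>ennreal\<close> truncates neither.\<close>

lemma measure_variation_le:
  assumes "signed_measure M \<mu>" "total_variation M \<mu> (space M) < \<infinity>"
  shows "measure (pos_variation M \<mu>) (space M) + measure (neg_variation M \<mu>) (space M)
    \<le> enn2real (total_variation M \<mu> (space M))"
proof -
  define tv where "tv = enn2real (total_variation M \<mu> (space M))"
  have "\<bar>\<mu> (space M)\<bar> \<le> tv"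
    using enn2real_mono[OF abs_le_total_variation[OF assms(1) sets.top]] assms(2)
    by (simp add: tv_def)
  moreover have "measure (pos_variation M \<mu>) (space M) \<le> enn2real (ennreal ((tv + \<mu> (space M)) / 2))"
    unfolding measure_def pos_variation_def tv_def by (intro enn2real_mono emeasure_measure_of_le) simp
  moreover have "measure (neg_variation M \<mu>) (space M) \<le> enn2real (ennreal ((tv - \<mu> (space M)) / 2))"
    unfolding measure_def neg_variation_def tv_def by (intro enn2real_mono emeasure_measure_of_le) simp
  ultimately show ?thesis
    by (simp add: tv_def[symmetric] field_simps)
qed

lemma (in finite_measure) abs_integral_le:
  fixes g :: "'a \<Rightarrow> real"
  assumes "g \<in> borel_measurable M" "\<And>v. v \<in> space M \<Longrightarrow> \<bar>g v\<bar> \<le> c"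
  shows "\<bar>\<integral>v. g v \<partial>M\<bar> \<le> c * measure M (space M)"
proof -
  have int: "integrable M g"
    using assms by (intro integrable_const_bound[where B = c] AE_I2) auto
  have "\<bar>\<integral>v. g v \<partial>M\<bar> \<le> (\<integral>v. \<bar>g v\<bar> \<partial>M)"
    by (rule integral_abs_bound)
  also have "\<dots> \<le> (\<integral>v. c \<partial>M)"
    using int assms(2) by (intro integral_mono) auto
  finally show ?thesis
    by (simp add: mult.commute)
qed

lemma abs_signed_integral_le:
  assumes "signed_measure M \<mu>" "total_variation M \<mu> (space M) < \<infinity>"
    and g: "g \<in> borel_measurable M" "\<And>v. v \<in> space M \<Longrightarrow> \<bar>g v\<bar> \<le> c" and c: "0 \<le> c"
  shows "\<bar>signed_integral M \<mu> g\<bar> \<le> c * enn2real (total_variation M \<mu> (space M))"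
proof -
  interpret p: finite_measure "pos_variation M \<mu>" by (rule finite_measure_variation)
  interpret q: finite_measure "neg_variation M \<mu>" by (rule finite_measure_variation)
  have "\<bar>signed_integral M \<mu> g\<bar> \<le>
      c * measure (pos_variation M \<mu>) (space M) + c * measure (neg_variation M \<mu>) (space M)"
    using p.abs_integral_le[of g c] q.abs_integral_le[of g c] g
    by (simp add: signed_integral_def)
  also have "\<dots> \<le> c * enn2real (total_variation M \<mu> (space M))"
    using mult_left_mono[OF measure_variation_le[OF assms(1,2)] c] by (simp add: distrib_left)
  finally show ?thesis .
qed

lemma integrable_variation:
  fixes g :: "'a \<Rightarrow> real"
  assumes "g \<in> borel_measurable M" "\<And>v. v \<in> space M \<Longrightarrow> \<bar>g v\<bar> \<le> c"
  shows "integrable (pos_variation M \<mu>) g" "integrable (neg_variation M \<mu>) g"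
  using assms
  by (auto intro!: finite_measure.integrable_const_bound[where B = c] finite_measure_variation AE_I2)

lemma signed_integral_sum:
  assumes "\<And>i. i \<in> I \<Longrightarrow> g i \<in> borel_measurable M"
    and "\<And>i v. i \<in> I \<Longrightarrow> v \<in> space M \<Longrightarrow> \<bar>g i v\<bar> \<le> c"
  shows "signed_integral M \<mu> (\<lambda>v. \<Sum>i\<in>I. k i * g i v) = (\<Sum>i\<in>I. k i * signed_integral M \<mu> (g i))"
proof -
  have "integrable (pos_variation M \<mu>) (g i)" "integrable (neg_variation M \<mu>) (g i)" if "i \<in> I" for i
    using that assms by (auto intro!: integrable_variation)
  then show ?thesis
    unfolding signed_integral_def
    by (subst (1 2) Bochner_Integration.integral_sum) (auto simp: sum_subtractf right_diff_distrib)
qed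

lemma signed_integral_diff:
  assumes "f \<in> borel_measurable M" "g \<in> borel_measurable M"
    and "\<And>v. v \<in> space M \<Longrightarrow> \<bar>f v\<bar> \<le> c" "\<And>v. v \<in> space M \<Longrightarrow> \<bar>g v\<bar> \<le> c"
  shows "signed_integral M \<mu> (\<lambda>v. f v - g v) = signed_integral M \<mu> f - signed_integral M \<mu> g"
  unfolding signed_integral_def
  using integrable_variation[OF assms(1,3)] integrable_variation[OF assms(2,4)] by simp


subsection \<open>Finitely supported signed measures\<close>

lemma sums_sum_Int:
  fixes a :: "'a \<Rightarrow> real"
  assumes "finite V" "disjoint_family A"
  shows "(\<lambda>i. \<Sum>v\<in>V \<inter> A i. a v) sums (\<Sum>v\<in>V \<inter> (\<Union>i. A i). a v)"
proof -
  have "(\<lambda>i. a v * indicator (A i) v) sums (a v * indicator (\<Union>i. A i) v)" for v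
    using assms(2) by (intro sums_mult indicator_sums) (auto simp: disjoint_family_on_def)
  then have "(\<lambda>i. \<Sum>v\<in>V. a v * indicator (A i) v) sums (\<Sum>v\<in>V. a v * indicator (\<Union>i. A i) v)"
    by (rule sums_sum)
  moreover have "(\<Sum>v\<in>V. a v * indicator B v) = (\<Sum>v\<in>V \<inter> B. a v)" for B
    using assms(1) by (auto simp: sum.inter_restrict indicator_def intro!: sum.cong)
  ultimately show ?thesis
    by simp
qed

lemma signed_measure_finite_support:
  assumes "finite V"
  shows "signed_measure M (\<lambda>A. \<Sum>v\<in>V \<inter> A. a v)"
  unfolding signed_measure_def using sums_sum_Int[OF assms] by auto

text \<open>The upper bound is the triangle inequality on each block. It is attained by a partition
  into two blocks on which the atoms have constant sign.\<close>

lemma total_variation_finite_support: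
  assumes V: "finite V" "\<And>v. v \<in> V \<Longrightarrow> {v} \<in> sets M" and E: "E \<in> sets M"
  shows "total_variation M (\<lambda>A. \<Sum>v\<in>V \<inter> A. a v) E = ennreal (\<Sum>v\<in>V \<inter> E. \<bar>a v\<bar>)"
proof (rule antisym)
  show "total_variation M (\<lambda>A. \<Sum>v\<in>V \<inter> A. a v) E \<le> ennreal (\<Sum>v\<in>V \<inter> E. \<bar>a v\<bar>)"
    unfolding total_variation_def
  proof (rule SUP_least, clarify)
    fix A :: "nat \<Rightarrow> 'a set" assume A: "disjoint_family A" "E = (\<Union>i. A i)"
    have "(\<Sum>i. ennreal \<bar>\<Sum>v\<in>V \<inter> A i. a v\<bar>) \<le> (\<Sum>i. ennreal (\<Sum>v\<in>V \<inter> A i. \<bar>a v\<bar>))"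
      by (intro suminf_le ennreal_leI) auto
    also have "\<dots> = ennreal (\<Sum>v\<in>V \<inter> (\<Union>i. A i). \<bar>a v\<bar>)"
      by (rule suminf_ennreal_eq[OF _ sums_sum_Int[OF V(1) A(1)]]) (auto intro: sum_nonneg)
    finally show "(\<Sum>i. ennreal \<bar>\<Sum>v\<in>V \<inter> A i. a v\<bar>) \<le> ennreal (\<Sum>v\<in>V \<inter> (\<Union>i. A i). \<bar>a v\<bar>)" .
  qed
  \<comment> \<open>A Hahn set: the atoms of positive weight. It is measurable as a finite union of
    measurable singletons.\<close>
  define H where "H = {v \<in> V. 0 < a v}"
  have "(\<Union>v\<in>H. {v}) \<in> sets M"
    using V by (intro sets.finite_UN) (auto simp: H_def)
  then have H: "H \<in> sets M"
    by simp
  let ?A = "binaryset (E \<inter> H) (E - H)"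
  have "?A \<in> {A. range A \<subseteq> sets M \<and> disjoint_family A \<and> (\<Union>i. A i) = E}"
    using binaryset_partition[of "E \<inter> H" M "E - H"] E H by (simp add: Int_Diff_disjoint Int_Diff_Un)
  then have "(\<Sum>i. ennreal \<bar>\<Sum>v\<in>V \<inter> ?A i. a v\<bar>) \<le> total_variation M (\<lambda>A. \<Sum>v\<in>V \<inter> A. a v) E"
    unfolding total_variation_def by (rule SUP_upper)
  moreover have "(\<Sum>i. ennreal \<bar>\<Sum>v\<in>V \<inter> ?A i. a v\<bar>) =
      ennreal \<bar>\<Sum>v\<in>V \<inter> (E \<inter> H). a v\<bar> + ennreal \<bar>\<Sum>v\<in>V \<inter> (E - H). a v\<bar>"
    by (rule suminf_binaryset_eq) simp
  moreover have "\<bar>\<Sum>v\<in>V \<inter> (E \<inter> H). a v\<bar> = (\<Sum>v\<in>V \<inter> (E \<inter> H). \<bar>a v\<bar>)"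
    by (subst abs_of_nonneg) (auto simp: H_def intro!: sum_nonneg sum.cong)
  moreover have "\<bar>\<Sum>v\<in>V \<inter> (E - H). a v\<bar> = (\<Sum>v\<in>V \<inter> (E - H). \<bar>a v\<bar>)"
    by (subst abs_of_nonpos) (auto simp: H_def sum_negf[symmetric] intro!: sum_nonpos sum.cong)
  moreover have "(\<Sum>v\<in>V \<inter> E. \<bar>a v\<bar>) = (\<Sum>v\<in>V \<inter> (E \<inter> H). \<bar>a v\<bar>) + (\<Sum>v\<in>V \<inter> (E - H). \<bar>a v\<bar>)"
    using V(1) by (subst sum.union_disjoint[symmetric]) (auto intro!: sum.cong)
  ultimately show "ennreal (\<Sum>v\<in>V \<inter> E. \<bar>a v\<bar>) \<le> total_variation M (\<lambda>A. \<Sum>v\<in>V \<inter> A. a v) E"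
    by (simp add: sum_nonneg flip: ennreal_plus)
qed

text \<open>Here the value of \<open>measure_of\<close> has to be known exactly, so a genuine
  measure with the prescribed values is exhibited: the image in \<open>M\<close> of the point
  measure on \<open>V\<close>.\<close>

lemma integral_measure_of_finite_support:
  fixes g :: "'a \<Rightarrow> real"
  assumes V: "finite V" "V \<subseteq> space M" and b: "\<And>v. 0 \<le> b v" and g: "g \<in> borel_measurable M"
  shows "(\<integral>v. g v \<partial>measure_of (space M) (sets M) (\<lambda>E. ennreal (\<Sum>v\<in>V \<inter> E. b v))) = (\<Sum>v\<in>V. b v * g v)"
proof -
  define P where "P = distr (point_measure V (\<lambda>v. ennreal (b v))) M (\<lambda>v. v)"
  have ms: "(\<lambda>v. v) \<in> measurable (point_measure V (\<lambda>v. ennreal (b v))) M"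
    using V(2) by (auto simp: measurable_point_measure_eq1)
  have em: "emeasure P E = ennreal (\<Sum>v\<in>V \<inter> E. b v)" if "E \<in> sets M" for E
    using that V(1) b ms
    by (simp add: P_def emeasure_distr emeasure_point_measure_finite space_point_measure sum_ennreal Int_commute)
  have "measure_of (space M) (sets M) (\<lambda>E. ennreal (\<Sum>v\<in>V \<inter> E. b v)) = P"
    using measure_of_eq[OF sets.space_closed, of M "emeasure P" "\<lambda>E. ennreal (\<Sum>v\<in>V \<inter> E. b v)"] em
      measure_of_of_measure[of P]
    by (simp add: sets.sigma_sets_eq) (simp add: P_def)
  moreover have "(\<integral>v. g v \<partial>P) = (\<Sum>v\<in>V. b v * g v)"
    using V(1) b g ms by (simp add: P_def integral_distr lebesgue_integral_point_measure_finite)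
  ultimately show ?thesis
    by simp
qed

lemma signed_integral_finite_support:
  assumes V: "finite V" "\<And>v. v \<in> V \<Longrightarrow> {v} \<in> sets M" and g: "g \<in> borel_measurable M"
  shows "signed_integral M (\<lambda>A. \<Sum>v\<in>V \<inter> A. a v) g = (\<Sum>v\<in>V. a v * g v)"
proof -
  have sub: "V \<subseteq> space M"
    using V(2) sets.sets_into_space by blast
  \<comment> \<open>The factors c = 1 and c = -1 cover the positive and the negative part at once;
    their atoms have masses \<open>(\<bar>a v\<bar> + a v) / 2\<close> and
    \<open>(\<bar>a v\<bar> - a v) / 2\<close>.\<close>
  have tv: "(enn2real (total_variation M (\<lambda>A. \<Sum>v\<in>V \<inter> A. a v) E) + c * (\<Sum>v\<in>V \<inter> E. a v)) / 2 =
      (\<Sum>v\<in>V \<inter> E. (\<bar>a v\<bar> + c * a v) / 2)" if "E \<in> sigma_sets (space M) (sets M)" for E c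
    using that total_variation_finite_support[OF V, of E a]
    by (simp add: sets.sigma_sets_eq sum_nonneg sum.distrib sum_distrib_left flip: sum_divide_distrib)
  have mof: "measure_of (space M) (sets M) (\<lambda>E. ennreal
      ((enn2real (total_variation M (\<lambda>A. \<Sum>v\<in>V \<inter> A. a v) E) + c * (\<Sum>v\<in>V \<inter> E. a v)) / 2)) =
    measure_of (space M) (sets M) (\<lambda>E. ennreal (\<Sum>v\<in>V \<inter> E. (\<bar>a v\<bar> + c * a v) / 2))" for c
    by (rule measure_of_eq[OF sets.space_closed]) (simp only: tv)
  have nonneg: "0 \<le> (\<bar>a v\<bar> + a v) / 2" "0 \<le> (\<bar>a v\<bar> - a v) / 2" for v
    by auto
  show ?thesis
    unfolding signed_integral_def pos_variation_def neg_variation_def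
    using mof[of 1] mof[of "- 1"]
      integral_measure_of_finite_support[OF V(1) sub nonneg(1) g]
      integral_measure_of_finite_support[OF V(1) sub nonneg(2) g]
    by (simp add: sum_subtractf[symmetric]) (auto intro!: sum.cong simp: field_simps)
qed


subsection \<open>Neurons\<close>

lemma norm_n_nonneg [simp]: "0 \<le> norm_n d x"
  by (simp add: norm_n_def L2_set_nonneg)

lemma norm_n_power2: "(norm_n d x)\<^sup>2 = (\<Sum>i<d. (x i)\<^sup>2)"
  by (simp add: norm_n_def L2_set_def sum_nonneg)

lemma abs_le_norm_n: "i < d \<Longrightarrow> \<bar>x i\<bar> \<le> norm_n d x"
  unfolding norm_n_def L2_set_def
  by (intro real_le_rsqrt) (auto intro: member_le_sum[of i "{..<d}" "\<lambda>i. (x i)\<^sup>2"])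

lemma abs_inner_n_le: "\<bar>inner_n d u v\<bar> \<le> norm_n d u * norm_n d v"
proof -
  have "\<bar>inner_n d u v\<bar> \<le> (\<Sum>i<d. \<bar>u i\<bar> * \<bar>v i\<bar>)"
    unfolding inner_n_def by (rule order.trans[OF sum_abs]) (simp add: abs_mult)
  also have "\<dots> \<le> norm_n d u * norm_n d v"
    unfolding norm_n_def by (rule L2_set_mult_ineq)
  finally show ?thesis .
qed

lemma inner_n_lift: "inner_n (Suc d) v (x(d := R)) = inner_n d v x + v d * R"
  by (simp add: inner_n_def)

lemma inner_n_sum_right: "inner_n m v (\<lambda>k. \<Sum>i\<in>I. c i * z i k) = (\<Sum>i\<in>I. c i * inner_n m v (z i))"
  unfolding inner_n_def sum_distrib_left by (subst sum.swap) (simp add: ac_simps)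

lemma norm_n_lift_le:
  assumes "norm_n d x \<le> R" "0 \<le> R"
  shows "norm_n (Suc d) (x(d := R)) \<le> sqrt 2 * R"
proof (rule power2_le_imp_le)
  have "(norm_n (Suc d) (x(d := R)))\<^sup>2 = (norm_n d x)\<^sup>2 + R\<^sup>2"
    by (simp add: norm_n_power2)
  also have "(norm_n d x)\<^sup>2 \<le> R\<^sup>2"
    using assms(1) by (intro power_mono) auto
  finally show "(norm_n (Suc d) (x(d := R)))\<^sup>2 \<le> (sqrt 2 * R)\<^sup>2"
    by (simp add: power_mult_distrib)
qed (use assms in auto)

text \<open>Cauchy-Schwarz with |z| at most sqrt 2 R. Weights range over the ball of radius 1/R
  rather than its sphere, so that the zero weight is included when a supremum is taken
  later.\<close>

lemma abs_inner_lift_le: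
  assumes "norm_n d x \<le> R" "0 < R" "norm_n (Suc d) v \<le> 1 / R"
  shows "\<bar>inner_n (Suc d) v (x(d := R))\<bar> \<le> sqrt 2"
proof -
  have "\<bar>inner_n (Suc d) v (x(d := R))\<bar> \<le> 1 / R * (sqrt 2 * R)"
    using assms norm_n_lift_le[of d x R] by (intro order.trans[OF abs_inner_n_le] mult_mono) auto
  then show ?thesis
    using assms(2) by simp
qed

text \<open>Induction by splitting off one factor. The power \<open>M ^ n\<close> instead of n - 1
  costs a constant and avoids truncated subtraction; 1 \<le> M allows raising the exponent.\<close>

lemma abs_power_diff_le:
  fixes a b M :: real
  assumes "0 \<le> a" "a \<le> M" "0 \<le> b" "b \<le> M" "1 \<le> M"
  shows "\<bar>a ^ n - b ^ n\<bar> \<le> real n * M ^ n * \<bar>a - b\<bar>"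
proof (induction n)
  case (Suc n)
  have "a ^ Suc n - b ^ Suc n = a * (a ^ n - b ^ n) + (a - b) * b ^ n"
    by (simp add: algebra_simps)
  then have "\<bar>a ^ Suc n - b ^ Suc n\<bar> \<le> a * \<bar>a ^ n - b ^ n\<bar> + \<bar>a - b\<bar> * b ^ n"
    using abs_triangle_ineq[of "a * (a ^ n - b ^ n)" "(a - b) * b ^ n"] assms by (simp add: abs_mult)
  also have "\<dots> \<le> M * (real n * M ^ n * \<bar>a - b\<bar>) + \<bar>a - b\<bar> * M ^ Suc n"
  proof (intro add_mono mult_mono Suc.IH)
    show "b ^ n \<le> M ^ Suc n"
      using assms power_mono[of b M n] power_increasing[of n "Suc n" M] by linarith
  qed (use assms in auto)
  finally show ?case
    by (simp add: algebra_simps)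
qed simp

text \<open>A Lipschitz constant of the activation on [-sqrt 2, sqrt 2], the range of the
  preactivations.\<close>

definition ridge_lip :: "nat \<Rightarrow> real" where
  "ridge_lip \<alpha> = real \<alpha> * sqrt 2 ^ \<alpha>"

lemma ridge_lip_nonneg: "0 \<le> ridge_lip \<alpha>"
  by (simp add: ridge_lip_def)

lemma abs_ridge_diff_le:
  assumes "\<bar>a\<bar> \<le> sqrt 2" "\<bar>b\<bar> \<le> sqrt 2"
  shows "\<bar>(max a 0) ^ \<alpha> - (max b 0) ^ \<alpha>\<bar> \<le> ridge_lip \<alpha> * \<bar>a - b\<bar>"
proof -
  have "\<bar>(max a 0) ^ \<alpha> - (max b 0) ^ \<alpha>\<bar> \<le> ridge_lip \<alpha> * \<bar>max a 0 - max b 0\<bar>"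
    unfolding ridge_lip_def using assms by (intro abs_power_diff_le) auto
  also have "\<dots> \<le> ridge_lip \<alpha> * \<bar>a - b\<bar>"
    by (intro mult_left_mono ridge_lip_nonneg) auto
  finally show ?thesis .
qed

lemma abs_neuron_le:
  assumes "norm_n d x \<le> R" "0 < R" "norm_n (Suc d) v \<le> 1 / R"
  shows "\<bar>neuron \<alpha> d R x v\<bar> \<le> sqrt 2 ^ \<alpha>"
  using abs_inner_lift_le[OF assms] by (auto simp: neuron_def intro!: power_mono)

section \<open>Measurability on the ball and on the weight sphere\<close>

lemma space_weight_sphere:
  "space (weight_sphere d R) = {v \<in> {..<Suc d} \<rightarrow>\<^sub>E UNIV. norm_n (Suc d) v = 1 / R}"
  by (auto simp: weight_sphere_def space_restrict_space euclid_def space_PiM)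

lemma norm_n_measurable [measurable]: "norm_n d \<in> borel_measurable (euclid d)"
  unfolding norm_n_def L2_set_def euclid_def by measurable

lemma ball_n_sets [measurable]: "ball_n d R \<in> sets (euclid d)"
proof -
  have "{x \<in> space (euclid d). norm_n d x \<le> R} \<in> sets (euclid d)"
    by measurable
  then show ?thesis
    by (simp add: ball_n_def euclid_def space_PiM)
qed

lemma euclid_component: "i < d \<Longrightarrow> (\<lambda>x. x i) \<in> borel_measurable (euclid d)"
  unfolding euclid_def by (intro measurable_component_singleton) simp

lemma weight_sphere_component: "i < Suc d \<Longrightarrow> (\<lambda>v. v i) \<in> borel_measurable (weight_sphere d R)"
  unfolding weight_sphere_def by (intro measurable_restrict_space1 euclid_component)

lemma neuron_measurable2:
  "(\<lambda>(x, v). neuron \<alpha> d R x v) \<in> borel_measurable (euclid d \<Otimes>\<^sub>M weight_sphere d R)"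
  unfolding neuron_def inner_n_lift split_def unfolding inner_n_def
  by (intro borel_measurable_power borel_measurable_max borel_measurable_add borel_measurable_sum
      borel_measurable_times borel_measurable_const
      measurable_compose[OF measurable_fst euclid_component]
      measurable_compose[OF measurable_snd weight_sphere_component]) auto

lemma neuron_measurable: "neuron \<alpha> d R x \<in> borel_measurable (weight_sphere d R)"
  unfolding neuron_def inner_n_def
  by (intro borel_measurable_power borel_measurable_max borel_measurable_sum
      borel_measurable_times borel_measurable_const weight_sphere_component) auto

text \<open>A point is a finite product of singletons. This allows signed measures on the sphere to
  have atoms with measurable support.\<close>

lemma weight_sphere_singleton:
  assumes "v \<in> space (weight_sphere d R)"
  shows "{v} \<in> sets (weight_sphere d R)"
proof -
  have "{v} = (\<Pi>\<^sub>E i\<in>{..<Suc d}. {v i})"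
    using assms PiE_singleton[of v "{..<Suc d}"] by (simp add: space_weight_sphere PiE_def)
  also have "\<dots> \<in> sets (euclid (Suc d))"
    unfolding euclid_def by (intro sets_PiM_I_finite) auto
  finally have "{v} \<in> sets (euclid (Suc d))" .
  moreover have "{v} = {v \<in> {..<Suc d} \<rightarrow>\<^sub>E UNIV. norm_n (Suc d) v = 1 / R} \<inter> {v}"
    using assms by (auto simp: space_weight_sphere)
  ultimately show ?thesis
    unfolding weight_sphere_def sets_restrict_space by (rule rev_image_eqI)
qed


subsection \<open>Rademacher complexity of the variation ball\<close>

text \<open>Averaging over the sign of \<open>z n\<close> replaces the offset y by y + z n and y - z
  n. Concavity of the square root brings the average inside, and the parallelogram law turns the
  mean of the two squared norms into the sum of the squared norms of y and z n.\<close>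

lemma sign_avg_norm_offset:
  "sign_avg n (\<lambda>\<epsilon>. norm_n m (\<lambda>k. y k + (\<Sum>i<n. \<epsilon> i * z i k))) \<le>
    sqrt ((norm_n m y)\<^sup>2 + (\<Sum>i<n. (norm_n m (z i))\<^sup>2))"
proof (induction n arbitrary: y)
  case (Suc n)
  define S where "S = (\<Sum>i<n. (norm_n m (z i))\<^sup>2)"
  have S: "0 \<le> S"
    by (simp add: S_def sum_nonneg)
  have eq: "(\<lambda>k. y k + (\<Sum>i<Suc n. (\<epsilon>(n := c)) i * z i k)) =
      (\<lambda>k. (y k + c * z n k) + (\<Sum>i<n. \<epsilon> i * z i k))" for c \<epsilon>
    by (simp add: algebra_simps)
  define p q where "p = (norm_n m (\<lambda>k. y k + 1 * z n k))\<^sup>2 + S"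
    and "q = (norm_n m (\<lambda>k. y k + (- 1) * z n k))\<^sup>2 + S"
  have "sign_avg (Suc n) (\<lambda>\<epsilon>. norm_n m (\<lambda>k. y k + (\<Sum>i<Suc n. \<epsilon> i * z i k))) \<le> (sqrt p + sqrt q) / 2"
    unfolding sign_avg.simps eq p_def q_def S_def by (intro divide_right_mono add_mono Suc.IH) auto
  also have "\<dots> \<le> sqrt ((p + q) / 2)"
  proof (rule real_le_rsqrt)
    have "0 \<le> p" "0 \<le> q"
      using S by (auto simp: p_def q_def)
    then have "((sqrt p + sqrt q) / 2)\<^sup>2 = (p + q + 2 * sqrt p * sqrt q) / 4"
      by (simp add: power_divide power2_sum)
    moreover have "2 * sqrt p * sqrt q \<le> (sqrt p)\<^sup>2 + (sqrt q)\<^sup>2"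
      by (rule sum_squares_bound)
    ultimately show "((sqrt p + sqrt q) / 2)\<^sup>2 \<le> (p + q) / 2"
      using \<open>0 \<le> p\<close> \<open>0 \<le> q\<close> by simp
  qed
  also have "(p + q) / 2 = (norm_n m y)\<^sup>2 + (\<Sum>i<Suc n. (norm_n m (z i))\<^sup>2)"
  proof -
    have "p + q = (\<Sum>k<m. (y k + z n k)\<^sup>2 + (y k - z n k)\<^sup>2) + 2 * S"
      by (simp add: p_def q_def norm_n_power2 sum.distrib)
    also have "(\<Sum>k<m. (y k + z n k)\<^sup>2 + (y k - z n k)\<^sup>2) = (\<Sum>k<m. 2 * (y k)\<^sup>2 + 2 * (z n k)\<^sup>2)"
      by (intro sum.cong refl) (simp add: power2_eq_square algebra_simps)
    finally show ?thesis
      by (simp add: S_def norm_n_power2 sum.distrib flip: sum_distrib_left)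
  qed
  finally show ?case .
qed simp

lemma sign_avg_norm:
  "sign_avg n (\<lambda>\<epsilon>. norm_n m (\<lambda>k. \<Sum>i<n. \<epsilon> i * z i k)) \<le> sqrt (\<Sum>i<n. (norm_n m (z i))\<^sup>2)"
  using sign_avg_norm_offset[of n m "\<lambda>_. 0" z] by (simp add: norm_n_def L2_set_def)

text \<open>The absolute value is present because it will be integrated against a signed measure.
  The contraction principle has none, so both signs of the sum are bounded separately, which gives
  the factor 2.\<close>

lemma sign_avg_neurons:
  assumes \<alpha>: "1 \<le> \<alpha>" and R: "0 < R" and x: "\<And>i. i < n \<Longrightarrow> norm_n d (x i) \<le> R"
  shows "sign_avg n (\<lambda>\<epsilon>. SUP v\<in>{v. norm_n (Suc d) v \<le> 1 / R}. \<bar>\<Sum>i<n. \<epsilon> i * neuron \<alpha> d R (x i) v\<bar>)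
    \<le> 2 * (ridge_lip \<alpha> * sqrt 2 * sqrt n)"
proof -
  define V where "V = {v. norm_n (Suc d) v \<le> 1 / R}"
  define z where "z = (\<lambda>i. (x i)(d := R))"
  define L where "L = ridge_lip \<alpha>"
  have L: "0 \<le> L"
    by (simp add: L_def ridge_lip_nonneg)
  have V: "(\<lambda>_. 0) \<in> V"
    using R by (simp add: V_def norm_n_def L2_set_def)
  then have V0: "V \<noteq> {}" by auto
  have inner_le: "\<bar>inner_n (Suc d) v (z i)\<bar> \<le> sqrt 2" if "v \<in> V" "i < n" for v i
    using that x[of i] R unfolding z_def V_def by (intro abs_inner_lift_le) auto
  have neuron: "\<bar>c * neuron \<alpha> d R (x i) v\<bar> \<le> sqrt 2 ^ \<alpha>" if "\<bar>c\<bar> = 1" "v \<in> V" "i < n" for c v i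
    using abs_neuron_le[of d "x i" R v \<alpha>] that x[of i] R unfolding V_def by (auto simp: abs_mult)
  have bnd: "bounded ((\<lambda>v. L * inner_n (Suc d) v (z i)) ` V)" if "i < n" for i
    using mult_left_mono[OF inner_le[OF _ that] L] L by (auto simp: bounded_iff abs_mult)
  have bnd': "bounded ((\<lambda>v. c * neuron \<alpha> d R (x i) v) ` V)" if "\<bar>c\<bar> = 1" "i < n" for c i
    using neuron[OF that(1) _ that(2)] by (auto simp: bounded_iff)
  \<comment> \<open>The factor c = 1 or c = -1 selects the side of the absolute value; it does not
    affect the Lipschitz bound.\<close>
  have half: "sign_avg n (\<lambda>\<epsilon>. SUP v\<in>V. \<Sum>i<n. \<epsilon> i * (c * neuron \<alpha> d R (x i) v)) \<le> L * sqrt 2 * sqrt n"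
    if c: "\<bar>c\<bar> = 1" for c
  proof -
    have "sign_avg n (\<lambda>\<epsilon>. SUP v\<in>V. \<Sum>i<n. \<epsilon> i * (c * neuron \<alpha> d R (x i) v)) \<le>
        sign_avg n (\<lambda>\<epsilon>. SUP v\<in>V. \<Sum>i<n. \<epsilon> i * (L * inner_n (Suc d) v (z i)))"
    proof (rule sign_avg_contraction[OF V0])
      fix i v v' assume "i < n" "v \<in> V" "v' \<in> V"
      then have "\<bar>neuron \<alpha> d R (x i) v - neuron \<alpha> d R (x i) v'\<bar> \<le>
          L * \<bar>inner_n (Suc d) v (z i) - inner_n (Suc d) v' (z i)\<bar>"
        unfolding neuron_def z_def[symmetric] L_def
        using inner_le[of v i] inner_le[of v' i] unfolding z_def by (intro abs_ridge_diff_le) auto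
      then show "\<bar>c * neuron \<alpha> d R (x i) v - c * neuron \<alpha> d R (x i) v'\<bar> \<le>
          \<bar>L * inner_n (Suc d) v (z i) - L * inner_n (Suc d) v' (z i)\<bar>"
        using c L by (simp add: abs_mult flip: right_diff_distrib)
    qed (use bnd bnd' c in auto)
    \<comment> \<open>After contraction the sum is linear in v, so by Cauchy-Schwarz its supremum
      over the ball of radius 1/R is at most the norm of the signed sum of the inputs divided by
      R.\<close>
    also have "\<dots> \<le> sign_avg n (\<lambda>\<epsilon>. L / R * norm_n (Suc d) (\<lambda>k. \<Sum>i<n. \<epsilon> i * z i k))"
    proof (intro sign_avg_mono cSUP_least[OF V0])
      fix \<epsilon> v assume v: "v \<in> V"
      have "(\<Sum>i<n. \<epsilon> i * (L * inner_n (Suc d) v (z i))) =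
          L * inner_n (Suc d) v (\<lambda>k. \<Sum>i<n. \<epsilon> i * z i k)"
        by (simp add: inner_n_sum_right sum_distrib_left ac_simps)
      also have "\<dots> \<le> L * (norm_n (Suc d) v * norm_n (Suc d) (\<lambda>k. \<Sum>i<n. \<epsilon> i * z i k))"
        using abs_inner_n_le abs_le_D1 L by (blast intro: mult_left_mono)
      also have "\<dots> \<le> L * (1 / R * norm_n (Suc d) (\<lambda>k. \<Sum>i<n. \<epsilon> i * z i k))"
        using v L by (intro mult_left_mono mult_right_mono) (auto simp: V_def)
      finally show "(\<Sum>i<n. \<epsilon> i * (L * inner_n (Suc d) v (z i))) \<le>
          L / R * norm_n (Suc d) (\<lambda>k. \<Sum>i<n. \<epsilon> i * z i k)"
        by simp
    qed
    also have "\<dots> \<le> L / R * sqrt (\<Sum>i<n. (norm_n (Suc d) (z i))\<^sup>2)"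
      unfolding sign_avg_cmult using L R by (intro mult_left_mono sign_avg_norm) auto
    also have "\<dots> \<le> L / R * sqrt (\<Sum>i<n. (sqrt 2 * R)\<^sup>2)"
      using L R x by (intro mult_left_mono real_sqrt_le_mono sum_mono power_mono)
        (auto simp: z_def intro!: norm_n_lift_le)
    also have "\<dots> = L * sqrt 2 * sqrt n"
      using R by (simp add: power_mult_distrib real_sqrt_mult)
    finally show ?thesis .
  qed
  have "sign_avg n (\<lambda>\<epsilon>. SUP v\<in>V. \<bar>\<Sum>i<n. \<epsilon> i * neuron \<alpha> d R (x i) v\<bar>) \<le>
      sign_avg n (\<lambda>\<epsilon>. (SUP v\<in>V. \<Sum>i<n. \<epsilon> i * (1 * neuron \<alpha> d R (x i) v)) +
        (SUP v\<in>V. \<Sum>i<n. \<epsilon> i * ((- 1) * neuron \<alpha> d R (x i) v)))"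
  proof (intro sign_avg_mono cSUP_least[OF V0])
    fix \<epsilon> v assume v: "v \<in> V"
    have upper: "(\<Sum>i<n. \<epsilon> i * (c * neuron \<alpha> d R (x i) v)) \<le>
        (SUP v\<in>V. \<Sum>i<n. \<epsilon> i * (c * neuron \<alpha> d R (x i) v))" if "\<bar>c\<bar> = 1" "v \<in> V" for c v
      using bdd_signed_sum[of "\<lambda>_. 0" V n "\<lambda>i v. c * neuron \<alpha> d R (x i) v" \<epsilon>] bnd' that
      by (intro cSUP_upper) (auto simp: image_constant_conv)
    txt \<open>The zero weight makes both suprema nonnegative.\<close>
    have "neuron \<alpha> d R (x i) (\<lambda>_. 0) = 0" for i
      using \<alpha> by (simp add: neuron_def inner_n_def)
    then show "\<bar>\<Sum>i<n. \<epsilon> i * neuron \<alpha> d R (x i) v\<bar> \<le>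
        (SUP v\<in>V. \<Sum>i<n. \<epsilon> i * (1 * neuron \<alpha> d R (x i) v)) +
        (SUP v\<in>V. \<Sum>i<n. \<epsilon> i * ((- 1) * neuron \<alpha> d R (x i) v))"
      using upper[of 1 v] upper[of "- 1" v] upper[OF _ V, of 1] upper[OF _ V, of "- 1"] v
      by (simp add: sum_negf abs_le_iff)
  qed
  also have "\<dots> \<le> 2 * (L * sqrt 2 * sqrt n)"
    using half[of 1] half[of "- 1"] unfolding sign_avg_add by simp
  finally show ?thesis
    by (simp only: V_def L_def)
qed

text \<open>\<open>gamma1\<close> is an infimum; instead of showing that it is attained, a
  representing measure is chosen with mass at most any prescribed c > \<delta>.\<close>

lemma F1_ball_representation:
  assumes "f \<in> F1_ball \<alpha> d R \<delta>" "0 \<le> \<delta>" "\<delta> < c"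
  obtains \<mu> where "represents \<alpha> d R \<mu> f"
    "enn2real (total_variation (weight_sphere d R) \<mu> (space (weight_sphere d R))) \<le> c"
proof -
  have "gamma1 \<alpha> d R f < ennreal c"
    using assms le_less_trans[of "gamma1 \<alpha> d R f" "ennreal \<delta>" "ennreal c"]
    by (simp add: F1_ball_def ennreal_less_iff)
  then obtain \<mu> where \<mu>: "represents \<alpha> d R \<mu> f"
    "total_variation (weight_sphere d R) \<mu> (space (weight_sphere d R)) < ennreal c"
    unfolding gamma1_def by (auto simp: INF_less_iff)
  from \<mu>(2) have "enn2real (total_variation (weight_sphere d R) \<mu> (space (weight_sphere d R))) \<le> c"
    using assms by (intro enn2real_leI) auto
  with \<mu>(1) show thesis
    by (rule that)
qed

text \<open>The slack of the representing measure is removed by letting c decrease to \<delta>. The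
  sharp constant matters: predictions must not leave the interval on which the loss is
  Lipschitz.\<close>

lemma F1_ball_abs_le:
  assumes f: "f \<in> F1_ball \<alpha> d R \<delta>" and \<delta>: "0 \<le> \<delta>" and R: "0 < R" and x: "x \<in> ball_n d R"
  shows "\<bar>f x\<bar> \<le> sqrt 2 ^ \<alpha> * \<delta>"
proof -
  have "\<bar>f x\<bar> \<le> sqrt 2 ^ \<alpha> * c" if "\<delta> < c" for c
  proof -
    from F1_ball_representation[OF f \<delta> that] obtain \<mu> where \<mu>: "represents \<alpha> d R \<mu> f"
      "enn2real (total_variation (weight_sphere d R) \<mu> (space (weight_sphere d R))) \<le> c" .
    have "\<bar>f x\<bar> = \<bar>signed_integral (weight_sphere d R) \<mu> (neuron \<alpha> d R x)\<bar>"
      using \<mu>(1) x by (simp add: represents_def)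
    also have "\<dots> \<le> sqrt 2 ^ \<alpha> * enn2real (total_variation (weight_sphere d R) \<mu> (space (weight_sphere d R)))"
      using \<mu>(1) x R
      by (intro abs_signed_integral_le neuron_measurable abs_neuron_le)
        (auto simp: represents_def ball_n_def space_weight_sphere)
    also have "\<dots> \<le> sqrt 2 ^ \<alpha> * c"
      using \<mu>(2) by (intro mult_left_mono) auto
    finally show ?thesis .
  qed
  then have "\<bar>f x\<bar> / sqrt 2 ^ \<alpha> \<le> c" if "\<delta> < c" for c
    using that by (simp add: divide_le_eq mult.commute)
  then have "\<bar>f x\<bar> / sqrt 2 ^ \<alpha> \<le> \<delta>"
    by (rule dense_ge)
  then show ?thesis
    by (simp add: divide_le_eq mult.commute)
qed

text \<open>By linearity, the signed sum of values of f is the signed integral of the signed sum of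
  neurons. The factor 4 combines the mass 2 \<delta> of the chosen measure with the factor 2 of
  \<open>sign_avg_neurons\<close>.\<close>

lemma sign_avg_F1_ball:
  assumes \<alpha>: "1 \<le> \<alpha>" and R: "0 < R" and \<delta>: "0 < \<delta>"
    and x: "\<And>i. i < n \<Longrightarrow> x i \<in> ball_n d R"
    and T: "T \<subseteq> F1_ball \<alpha> d R \<delta>" "T \<noteq> {}"
  shows "sign_avg n (\<lambda>\<epsilon>. SUP f\<in>T. \<Sum>i<n. \<epsilon> i * f (x i)) \<le> 4 * \<delta> * (ridge_lip \<alpha> * sqrt 2 * sqrt n)"
proof -
  let ?M = "weight_sphere d R"
  define S where "S = (\<lambda>\<epsilon>. SUP v\<in>{v. norm_n (Suc d) v \<le> 1 / R}. \<bar>\<Sum>i<n. \<epsilon> i * neuron \<alpha> d R (x i) v\<bar>)"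
  have xR: "norm_n d (x i) \<le> R" if "i < n" for i
    using x[OF that] by (simp add: ball_n_def)
  have S: "\<bar>\<Sum>i<n. \<epsilon> i * neuron \<alpha> d R (x i) v\<bar> \<le> S \<epsilon>" if "norm_n (Suc d) v \<le> 1 / R" for \<epsilon> v
    unfolding S_def
  proof (rule cSUP_upper)
    show "bdd_above ((\<lambda>v. \<bar>\<Sum>i<n. \<epsilon> i * neuron \<alpha> d R (x i) v\<bar>) ` {v. norm_n (Suc d) v \<le> 1 / R})"
    proof (rule bdd_aboveI2)
      fix v assume "v \<in> {v. norm_n (Suc d) v \<le> 1 / R}"
      then show "\<bar>\<Sum>i<n. \<epsilon> i * neuron \<alpha> d R (x i) v\<bar> \<le> (\<Sum>i<n. \<bar>\<epsilon> i\<bar> * sqrt 2 ^ \<alpha>)"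
        using xR R by (intro order.trans[OF sum_abs] sum_mono)
          (auto simp: abs_mult intro!: mult_left_mono abs_neuron_le)
    qed
  qed (use that in simp)
  have S0: "0 \<le> S \<epsilon>" for \<epsilon>
    using S[of "\<lambda>_. 0" \<epsilon>] R by (force simp: norm_n_def L2_set_def)
  have "(\<Sum>i<n. \<epsilon> i * f (x i)) \<le> (2 * \<delta>) * S \<epsilon>" if f: "f \<in> T" for f \<epsilon>
  proof -
    have "f \<in> F1_ball \<alpha> d R \<delta>"
      using T f by auto
    then obtain \<mu> where \<mu>: "represents \<alpha> d R \<mu> f" "enn2real (total_variation ?M \<mu> (space ?M)) \<le> 2 * \<delta>"
      by (rule F1_ball_representation[where c = "2 * \<delta>"]) (use \<delta> in auto)
    have "(\<Sum>i<n. \<epsilon> i * f (x i)) = (\<Sum>i<n. \<epsilon> i * signed_integral ?M \<mu> (neuron \<alpha> d R (x i)))"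
      using \<mu>(1) x by (intro sum.cong) (auto simp: represents_def)
    also have "\<dots> = signed_integral ?M \<mu> (\<lambda>v. \<Sum>i<n. \<epsilon> i * neuron \<alpha> d R (x i) v)"
      using xR R
      by (intro signed_integral_sum[symmetric, where c = "sqrt 2 ^ \<alpha>"] neuron_measurable abs_neuron_le)
        (auto simp: space_weight_sphere)
    also have "\<bar>\<dots>\<bar> \<le> S \<epsilon> * enn2real (total_variation ?M \<mu> (space ?M))"
      using \<mu>(1)
      by (intro abs_signed_integral_le S S0 borel_measurable_sum borel_measurable_times
          borel_measurable_const neuron_measurable)
        (auto simp: represents_def space_weight_sphere)
    also have "\<dots> \<le> S \<epsilon> * (2 * \<delta>)"
      by (intro mult_left_mono \<mu> S0)
    finally show ?thesis
      by (simp add: mult.commute)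
  qed
  then have "sign_avg n (\<lambda>\<epsilon>. SUP f\<in>T. \<Sum>i<n. \<epsilon> i * f (x i)) \<le> sign_avg n (\<lambda>\<epsilon>. (2 * \<delta>) * S \<epsilon>)"
    using T(2) by (intro sign_avg_mono cSUP_least) auto
  also have "\<dots> \<le> (2 * \<delta>) * (2 * (ridge_lip \<alpha> * sqrt 2 * sqrt n))"
    unfolding sign_avg_cmult S_def using \<delta> by (intro mult_left_mono sign_avg_neurons \<alpha> R xR) auto
  finally show ?thesis
    by simp
qed


subsection \<open>Affine functions in the variation ball\<close>

text \<open>
  Lagrange interpolation of \<open>s \<mapsto> (1 + s * t) ^ \<alpha>\<close> at the nodes \<open>j / \<alpha>\<close>: the coefficient
  of \<open>s\<close>, which is \<open>\<alpha> * t\<close>, is a combination of the values at the nodes whose weights do not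
  depend on \<open>t\<close>.
\<close>

lemma linear_from_powers:
  assumes "1 \<le> \<alpha>"
  obtains a :: "nat \<Rightarrow> real"
  where "\<And>t. (\<Sum>j\<le>\<alpha>. a j * (1 + real j / real \<alpha> * t) ^ \<alpha>) = t"
proof -
  define r where "r = (\<lambda>j. real j / real \<alpha>)"
  have r_eq: "r i = r j \<longleftrightarrow> i = j" for i j
    using assms by (simp add: r_def)
  define L where "L = (\<lambda>j. smult (inverse (\<Prod>i\<in>{..\<alpha>} - {j}. r j - r i)) (\<Prod>i\<in>{..\<alpha>} - {j}. [:- r i, 1:]))"
  have L: "poly (L j) (r k) = (if j = k then 1 else 0)" if "k \<le> \<alpha>" for j k
    using that by (auto simp: L_def poly_prod r_eq)
  have deg_L: "degree (L j) \<le> \<alpha>" if "j \<le> \<alpha>" for j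
  proof -
    have "degree (\<Prod>i\<in>{..\<alpha>} - {j}. [:- r i, 1:]) \<le> (\<Sum>i\<in>{..\<alpha>} - {j}. 1)"
      by (rule order.trans[OF degree_prod_sum_le]) auto
    then show ?thesis
      using that by (simp add: L_def card_Diff_singleton_if)
  qed
  have "(\<Sum>j\<le>\<alpha>. (coeff (L j) 1 / real \<alpha>) * (1 + real j / real \<alpha> * t) ^ \<alpha>) = t" for t
  proof -
    define p where "p = [:1, t:] ^ \<alpha>"
    have poly_p: "poly p s = (1 + s * t) ^ \<alpha>" for s
      by (simp add: p_def)
    have "p = (\<Sum>j\<le>\<alpha>. smult (poly p (r j)) (L j))"
    proof (rule poly_eqI_degree)
      show "poly p s = poly (\<Sum>j\<le>\<alpha>. smult (poly p (r j)) (L j)) s" if "s \<in> r ` {..\<alpha>}" for s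
        using that by (auto simp: poly_sum L if_distrib cong: if_cong)
      have card: "card (r ` {..\<alpha>}) = Suc \<alpha>"
        by (subst card_image) (auto simp: inj_on_def r_eq)
      have "degree p \<le> degree [:1, t:] * \<alpha>"
        unfolding p_def by (rule degree_power_le)
      also have "\<dots> \<le> \<alpha>"
        by simp
      finally show "degree p < card (r ` {..\<alpha>})"
        by (simp add: card)
      have "degree (\<Sum>j\<le>\<alpha>. smult (poly p (r j)) (L j)) \<le> \<alpha>"
        using deg_L by (intro degree_sum_le) (auto intro: order.trans[OF degree_smult_le])
      then show "degree (\<Sum>j\<le>\<alpha>. smult (poly p (r j)) (L j)) < card (r ` {..\<alpha>})"
        by (simp add: card)
    qed
    then have "coeff p 1 = (\<Sum>j\<le>\<alpha>. poly p (r j) * coeff (L j) 1)"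
      by (metis (no_types, lifting) coeff_smult coeff_sum sum.cong)
    moreover have "coeff p 1 = real \<alpha> * t"
      unfolding p_def using assms by (subst coeff_linear_poly_power) auto
    ultimately have "real \<alpha> * t = (\<Sum>j\<le>\<alpha>. coeff (L j) 1 * (1 + real j / real \<alpha> * t) ^ \<alpha>)"
      by (simp add: poly_p r_def mult.commute)
    then have "t = (\<Sum>j\<le>\<alpha>. coeff (L j) 1 * (1 + real j / real \<alpha> * t) ^ \<alpha>) / real \<alpha>"
      using assms by (simp add: field_simps)
    then show ?thesis
      by (simp add: sum_divide_distrib)
  qed
  then show thesis
    by (rule that)
qed

text \<open>The measure has atoms at the \<open>v i\<close>. Coefficients of coinciding atoms are
  added up in \<open>a\<close>, which can only lower the total variation.\<close>

lemma neuron_sum_in_F1_ball: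
  assumes I: "finite I" and v: "\<And>i. i \<in> I \<Longrightarrow> v i \<in> space (weight_sphere d R)"
    and \<delta>: "(\<Sum>i\<in>I. \<bar>k i\<bar>) \<le> \<delta>"
  shows "(\<lambda>x\<in>ball_n d R. \<Sum>i\<in>I. k i * neuron \<alpha> d R x (v i)) \<in> F1_ball \<alpha> d R \<delta>"
    (is "?f \<in> _")
proof -
  let ?M = "weight_sphere d R"
  define a where "a = (\<lambda>u. \<Sum>i\<in>{i \<in> I. v i = u}. k i)"
  define \<mu> where "\<mu> = (\<lambda>A. \<Sum>u\<in>v ` I \<inter> A. a u)"
  have V: "finite (v ` I)" "\<And>u. u \<in> v ` I \<Longrightarrow> {u} \<in> sets ?M"
    using I v by (auto intro: weight_sphere_singleton)
  have "total_variation ?M \<mu> (space ?M) = ennreal (\<Sum>u\<in>v ` I \<inter> space ?M. \<bar>a u\<bar>)"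
    unfolding \<mu>_def by (rule total_variation_finite_support[OF V sets.top])
  also have "v ` I \<inter> space ?M = v ` I"
    using v by auto
  also have "(\<Sum>u\<in>v ` I. \<bar>a u\<bar>) \<le> (\<Sum>u\<in>v ` I. \<Sum>i\<in>{i \<in> I. v i = u}. \<bar>k i\<bar>)"
    unfolding a_def by (intro sum_mono sum_abs)
  also have "\<dots> = (\<Sum>i\<in>I. \<bar>k i\<bar>)"
    by (rule sum.image_gen[OF I, symmetric])
  finally have tv: "total_variation ?M \<mu> (space ?M) \<le> ennreal \<delta>"
    using \<delta> by (auto simp: ennreal_leI intro: order.trans)
  have "represents \<alpha> d R \<mu> ?f"
    unfolding represents_def
  proof (intro conjI ballI)
    show "signed_measure ?M \<mu>"
      unfolding \<mu>_def by (rule signed_measure_finite_support[OF V(1)])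
    show "total_variation ?M \<mu> (space ?M) < \<infinity>"
      using tv by (rule le_less_trans) simp
    fix x assume x: "x \<in> ball_n d R"
    have "signed_integral ?M \<mu> (neuron \<alpha> d R x) = (\<Sum>u\<in>v ` I. a u * neuron \<alpha> d R x u)"
      unfolding \<mu>_def by (rule signed_integral_finite_support[OF V neuron_measurable])
    also have "\<dots> = (\<Sum>u\<in>v ` I. \<Sum>i\<in>{i \<in> I. v i = u}. k i * neuron \<alpha> d R x (v i))"
      unfolding a_def sum_distrib_right by (intro sum.cong) auto
    also have "\<dots> = (\<Sum>i\<in>I. k i * neuron \<alpha> d R x (v i))"
      by (rule sum.image_gen[OF I, symmetric])
    finally show "?f x = signed_integral ?M \<mu> (neuron \<alpha> d R x)"
      using x by simp
  qed simp
  then show ?thesis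
    unfolding F1_ball_def F1_def gamma1_def using tv by (auto intro: INF_lower2)
qed

text \<open>A unit direction is also required for w = 0, where any unit vector will do; 1 \<le> d
  provides a coordinate vector.\<close>

lemma norm_n_direction:
  assumes "1 \<le> d"
  obtains e where "norm_n d e = 1" "\<And>i. i < d \<Longrightarrow> w i = norm_n d w * e i"
proof (cases "norm_n d w = 0")
  case True
  define e :: "nat \<Rightarrow> real" where "e = (\<lambda>i. if i = 0 then 1 else 0)"
  have "(norm_n d e)\<^sup>2 = (\<Sum>i<d. if i = 0 then 1 else 0)"
    unfolding norm_n_power2 by (intro sum.cong) (auto simp: e_def)
  then have "(norm_n d e)\<^sup>2 = 1\<^sup>2"
    using assms by simp
  then have "norm_n d e = 1"
    by (rule power2_eq_imp_eq) auto
  moreover have "w i = 0" if "i < d" for i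
    using abs_le_norm_n[OF that, of w] True by simp
  ultimately show thesis
    using True by (intro that) auto
next
  case False
  define e where "e = (\<lambda>i. w i / norm_n d w)"
  have "(norm_n d e)\<^sup>2 = (\<Sum>i<d. (w i)\<^sup>2) / (norm_n d w)\<^sup>2"
    by (subst norm_n_power2) (simp add: e_def power_divide sum_divide_distrib)
  then have "(norm_n d e)\<^sup>2 = 1\<^sup>2"
    using False by (simp flip: norm_n_power2)
  then have "norm_n d e = 1"
    by (rule power2_eq_imp_eq) auto
  then show thesis
    using False by (intro that) (auto simp: e_def)
qed

lemma affine_in_F1_ball:
  assumes \<alpha>: "1 \<le> \<alpha>"
  obtains c where "0 < c"
    "\<And>d R \<eta> w b. 1 \<le> d \<Longrightarrow> 0 < R \<Longrightarrow> norm_n d w \<le> \<eta> \<Longrightarrow> \<bar>b\<bar> \<le> R * \<eta> \<Longrightarrow>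
      (\<lambda>x\<in>ball_n d R. inner_n d w x + b) \<in> F1_ball \<alpha> d R (c * R * \<eta>)"
proof -
  obtain a :: "nat \<Rightarrow> real" where a: "\<And>t. (\<Sum>j\<le>\<alpha>. a j * (1 + real j / real \<alpha> * t) ^ \<alpha>) = t"
    using linear_from_powers[OF \<alpha>] by blast
  define r where "r = (\<lambda>j. real j / real \<alpha>)"
  define s where "s = (\<lambda>j. sqrt (1 + (r j)\<^sup>2))"
  have r: "0 \<le> r j" "r j \<le> 1" if "j \<le> \<alpha>" for j
    using that \<alpha> by (auto simp: r_def)
  have s: "1 \<le> s j" "(s j)\<^sup>2 = 1 + (r j)\<^sup>2" for j
    by (auto simp: s_def)
  have s_neq: "s j \<noteq> 0" for j
    using s(1)[of j] by auto
  have s_le: "s j \<le> sqrt 2" if "j \<le> \<alpha>" for j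
    using r[OF that] by (simp add: s_def power_le_one)
  \<comment> \<open>The power of sqrt 2 bounds \<open>s j ^ \<alpha>\<close>, the sum pays for the
    linear part and the 1 for the intercept; both parts have size at most R \<eta>.\<close>
  define c where "c = sqrt 2 ^ \<alpha> * ((\<Sum>j\<le>\<alpha>. \<bar>a j\<bar>) + 1)"
  show thesis
  proof (rule that)
    show "0 < c"
      by (auto simp: c_def intro!: mult_pos_pos add_nonneg_pos sum_nonneg)
    fix d R \<eta> w b
    assume d: "1 \<le> (d :: nat)" and R: "0 < R" and w: "norm_n d w \<le> \<eta>" and b: "\<bar>b\<bar> \<le> R * \<eta>"
    obtain e where e: "norm_n d e = 1" "\<And>i. i < d \<Longrightarrow> w i = norm_n d w * e i"
      using norm_n_direction[OF d] by blast
    \<comment> \<open>The vector (r j e, 1) has length \<open>s j\<close> and is scaled to length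
      1/R. Its product with (x, R) is (1 + r j t) / s j, where t is the inner product of e and x
      divided by R.\<close>
    define v where "v = (\<lambda>j. \<lambda>i\<in>{..<Suc d}. (if i < d then r j * e i else 1) / (R * s j))"
    \<comment> \<open>\<open>s j ^ \<alpha>\<close> undoes the scaling of \<open>v j\<close>. At j =
      0 the node is 0 and the neuron is constantly 1 on the ball, so its coefficient also carries
      b.\<close>
    define k where "k = (\<lambda>j. s j ^ \<alpha> * (norm_n d w * R * a j + (if j = 0 then b else 0)))"
    have v: "v j \<in> space (weight_sphere d R)" for j
    proof -
      have "(norm_n (Suc d) (v j))\<^sup>2 = (\<Sum>i<d. (r j * e i / (R * s j))\<^sup>2) + (1 / (R * s j))\<^sup>2"
        by (simp add: norm_n_power2 v_def)
      also have "(\<Sum>i<d. (r j * e i / (R * s j))\<^sup>2) = (r j / (R * s j))\<^sup>2 * (norm_n d e)\<^sup>2"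
        by (simp add: norm_n_power2 sum_distrib_left power_mult_distrib power_divide)
      also have "\<dots> + (1 / (R * s j))\<^sup>2 = (1 / R)\<^sup>2"
        using R s(1)[of j] s(2)[of j] sum_power2_gt_zero_iff[of 1 "r j"]
        by (simp add: e power_divide power_mult_distrib add_divide_distrib[symmetric] add.commute)
      finally have "norm_n (Suc d) (v j) = 1 / R"
        by (rule power2_eq_imp_eq) (use R in auto)
      then show ?thesis
        by (simp add: space_weight_sphere v_def)
    qed
    have "(\<Sum>j\<le>\<alpha>. \<bar>k j\<bar>) \<le> (\<Sum>j\<le>\<alpha>. sqrt 2 ^ \<alpha> * (\<eta> * R * \<bar>a j\<bar> + (if j = 0 then R * \<eta> else 0)))"
    proof (rule sum_mono)
      fix j assume "j \<in> {..\<alpha>}"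
      then have j: "j \<le> \<alpha>" by simp
      have "\<bar>norm_n d w * R * a j + (if j = 0 then b else 0)\<bar> \<le>
          norm_n d w * R * \<bar>a j\<bar> + (if j = 0 then R * \<eta> else 0)"
        using R b abs_triangle_ineq[of "norm_n d w * R * a j" b] by (auto simp: abs_mult)
      also have "norm_n d w * R * \<bar>a j\<bar> \<le> \<eta> * R * \<bar>a j\<bar>"
        using w R by (intro mult_right_mono) auto
      finally have *: "\<bar>norm_n d w * R * a j + (if j = 0 then b else 0)\<bar> \<le>
          \<eta> * R * \<bar>a j\<bar> + (if j = 0 then R * \<eta> else 0)"
        by simp
      have "\<bar>k j\<bar> = s j ^ \<alpha> * \<bar>norm_n d w * R * a j + (if j = 0 then b else 0)\<bar>"
        using s(1)[of j] by (simp add: k_def abs_mult)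
      also have "\<dots> \<le> sqrt 2 ^ \<alpha> * (\<eta> * R * \<bar>a j\<bar> + (if j = 0 then R * \<eta> else 0))"
        using s(1)[of j] s_le[OF j] by (intro mult_mono power_mono *) auto
      finally show "\<bar>k j\<bar> \<le> sqrt 2 ^ \<alpha> * (\<eta> * R * \<bar>a j\<bar> + (if j = 0 then R * \<eta> else 0))" .
    qed
    also have "\<dots> = sqrt 2 ^ \<alpha> * (\<eta> * R * (\<Sum>j\<le>\<alpha>. \<bar>a j\<bar>) + R * \<eta>)"
      by (simp add: sum.distrib flip: sum_distrib_left)
    also have "\<dots> = c * R * \<eta>"
      by (simp add: c_def algebra_simps)
    finally have k: "(\<Sum>j\<le>\<alpha>. \<bar>k j\<bar>) \<le> c * R * \<eta>" .
    have "(\<Sum>j\<le>\<alpha>. k j * neuron \<alpha> d R x (v j)) = inner_n d w x + b" if x: "x \<in> ball_n d R" for x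
    proof -
      define t where "t = inner_n d e x / R"
      have "\<bar>inner_n d e x\<bar> \<le> R"
        using abs_inner_n_le[of d e x] x by (simp add: e(1) ball_n_def)
      then have t: "\<bar>t\<bar> \<le> 1"
        using R by (simp add: t_def)
      have "neuron \<alpha> d R x (v j) = (1 + r j * t) ^ \<alpha> / s j ^ \<alpha>" if "j \<le> \<alpha>" for j
      proof -
        have "inner_n (Suc d) (v j) (x(d := R)) = (1 + r j * t) / s j"
        proof -
          have "inner_n (Suc d) (v j) (x(d := R)) = (\<Sum>i<d. r j / (R * s j) * (e i * x i)) + 1 / s j"
            unfolding inner_n_lift unfolding inner_n_def using R by (simp add: v_def mult.assoc)
          also have "\<dots> = r j / (R * s j) * inner_n d e x + 1 / s j"
            by (simp add: inner_n_def sum_distrib_left)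
          also have "\<dots> = (1 + r j * t) / s j"
            using R s(1)[of j] by (simp add: t_def field_simps)
          finally show ?thesis .
        qed
        \<comment> \<open>As r j and |t| are at most 1, the positive part is inactive and the neuron
          is a plain power.\<close>
        moreover have "0 \<le> (1 + r j * t) / s j"
        proof -
          have "\<bar>r j * t\<bar> \<le> 1"
            unfolding abs_mult using r[OF that] t by (intro mult_le_one) auto
          then show ?thesis
            using s(1)[of j] by simp
        qed
        ultimately show ?thesis
          by (simp add: neuron_def power_divide)
      qed
      then have "(\<Sum>j\<le>\<alpha>. k j * neuron \<alpha> d R x (v j)) =
          (\<Sum>j\<le>\<alpha>. norm_n d w * R * (a j * (1 + real j / real \<alpha> * t) ^ \<alpha>) + (if j = 0 then b else 0))"
        using s_neq
        by (intro sum.cong refl) (auto simp: k_def r_def distrib_right)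
      also have "\<dots> = norm_n d w * R * t + b"
        by (simp only: sum.distrib sum_distrib_left[symmetric] a) simp
      also have "norm_n d w * R * t = norm_n d w * inner_n d e x"
        using R by (simp add: t_def)
      also have "\<dots> = inner_n d w x"
        using e(2) by (simp add: inner_n_def sum_distrib_left mult.assoc)
      finally show ?thesis .
    qed
    then have "(\<lambda>x\<in>ball_n d R. inner_n d w x + b) = (\<lambda>x\<in>ball_n d R. \<Sum>j\<le>\<alpha>. k j * neuron \<alpha> d R x (v j))"
      by auto
    also have "\<dots> \<in> F1_ball \<alpha> d R (c * R * \<eta>)"
      by (rule neuron_sum_in_F1_ball[OF _ v k]) simp
    finally show "(\<lambda>x\<in>ball_n d R. inner_n d w x + b) \<in> F1_ball \<alpha> d R (c * R * \<eta>)" .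
  qed
qed


subsection \<open>Finite nets\<close>

text \<open>Functions are sorted by the integer parts of f x / h. Only finitely many patterns occur,
  and one representative of each forms the net, so the net lies in \<open>S\<close>. It serves
  twice: for points, read as functions of the coordinate index, and for elements of the variation
  ball on finitely many points.\<close>

lemma finite_net_of_bounded_functions:
  fixes S :: "('x \<Rightarrow> real) set"
  assumes X: "finite X" and B: "\<And>f x. f \<in> S \<Longrightarrow> x \<in> X \<Longrightarrow> \<bar>f x\<bar> \<le> B" and h: "0 < h"
  shows "\<exists>T. finite T \<and> T \<subseteq> S \<and> (\<forall>f\<in>S. \<exists>g\<in>T. \<forall>x\<in>X. \<bar>f x - g x\<bar> \<le> h)"
proof -
  define \<Phi> where "\<Phi> = (\<lambda>f. \<lambda>x\<in>X. \<lfloor>f x / h\<rfloor>)"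
  have "\<lfloor>f x / h\<rfloor> \<in> {\<lfloor>- B / h\<rfloor>..\<lfloor>B / h\<rfloor>}" if "f \<in> S" "x \<in> X" for f x
  proof -
    have "- B \<le> f x" "f x \<le> B"
      using B[OF that] by (auto simp: abs_le_iff)
    then have "- B / h \<le> f x / h" "f x / h \<le> B / h"
      using h divide_right_mono[of _ _ h] by (simp_all only: less_imp_le)
    then show ?thesis
      by (simp only: atLeastAtMost_iff floor_mono)
  qed
  then have "\<Phi> ` S \<subseteq> (\<Pi>\<^sub>E x\<in>X. {\<lfloor>- B / h\<rfloor>..\<lfloor>B / h\<rfloor>})"
    by (auto simp: \<Phi>_def)
  then have "finite (\<Phi> ` S)"
    by (rule finite_subset) (intro finite_PiE X, simp)
  then have "\<exists>T\<subseteq>S. finite T \<and> \<Phi> ` S = \<Phi> ` T"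
    by (rule finite_subset_image) (rule order.refl)
  then obtain T where T: "T \<subseteq> S" "finite T" "\<Phi> ` S = \<Phi> ` T"
    by (elim exE conjE)
  have "\<exists>g\<in>T. \<forall>x\<in>X. \<bar>f x - g x\<bar> \<le> h" if "f \<in> S" for f
  proof -
    have "\<Phi> f \<in> \<Phi> ` T"
      using that unfolding T(3)[symmetric] by (rule imageI)
    then obtain g where g: "g \<in> T" "\<Phi> f = \<Phi> g"
      by (elim imageE)
    have "\<bar>f x - g x\<bar> \<le> h" if "x \<in> X" for x
    proof -
      have "\<lfloor>f x / h\<rfloor> = \<lfloor>g x / h\<rfloor>"
        using fun_cong[OF g(2), of x] that by (simp add: \<Phi>_def)
      then have "\<bar>f x / h - g x / h\<bar> \<le> 1"
        by linarith
      then show ?thesis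
        using h by (simp add: pos_divide_le_eq flip: diff_divide_distrib)
    qed
    with g(1) show ?thesis
      by blast
  qed
  with T(1,2) show ?thesis
    by blast
qed

text \<open>Each neuron has this modulus up to the mass 2 \<delta>. The crude factor d is harmless,
  as the modulus only serves to make nets finite.\<close>

lemma F1_ball_modulus:
  assumes f: "f \<in> F1_ball \<alpha> d R \<delta>" and \<delta>: "0 < \<delta>" and R: "0 < R"
    and x: "x \<in> ball_n d R" and y: "y \<in> ball_n d R" and h: "\<And>i. i < d \<Longrightarrow> \<bar>x i - y i\<bar> \<le> h" "0 \<le> h"
  shows "\<bar>f x - f y\<bar> \<le> 2 * \<delta> * (ridge_lip \<alpha> * (real d * (h / R)))"
proof -
  let ?M = "weight_sphere d R"
  obtain \<mu> where \<mu>: "represents \<alpha> d R \<mu> f" "enn2real (total_variation ?M \<mu> (space ?M)) \<le> 2 * \<delta>"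
    by (rule F1_ball_representation[where c = "2 * \<delta>", OF f]) (use \<delta> in auto)
  have xy: "norm_n d x \<le> R" "norm_n d y \<le> R"
    using x y by (auto simp: ball_n_def)
  have diff: "\<bar>neuron \<alpha> d R x v - neuron \<alpha> d R y v\<bar> \<le> ridge_lip \<alpha> * (real d * (h / R))"
    if "v \<in> space ?M" for v
  proof -
    have v: "norm_n (Suc d) v = 1 / R"
      using that by (simp add: space_weight_sphere)
    have "\<bar>inner_n (Suc d) v (x(d := R)) - inner_n (Suc d) v (y(d := R))\<bar> = \<bar>\<Sum>i<d. v i * (x i - y i)\<bar>"
      unfolding inner_n_lift unfolding inner_n_def by (simp add: sum_subtractf right_diff_distrib)
    also have "\<dots> \<le> (\<Sum>i<d. 1 / R * h)"
    proof (rule order.trans[OF sum_abs], rule sum_mono)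
      fix i assume "i \<in> {..<d}"
      then show "\<bar>v i * (x i - y i)\<bar> \<le> 1 / R * h"
        unfolding abs_mult using h abs_le_norm_n[of i "Suc d" v] v R by (intro mult_mono) auto
    qed
    finally have "\<bar>inner_n (Suc d) v (x(d := R)) - inner_n (Suc d) v (y(d := R))\<bar> \<le> real d * (h / R)"
      by simp
    then have "ridge_lip \<alpha> * \<bar>inner_n (Suc d) v (x(d := R)) - inner_n (Suc d) v (y(d := R))\<bar> \<le>
        ridge_lip \<alpha> * (real d * (h / R))"
      by (intro mult_left_mono ridge_lip_nonneg)
    moreover have "\<bar>neuron \<alpha> d R x v - neuron \<alpha> d R y v\<bar> \<le>
        ridge_lip \<alpha> * \<bar>inner_n (Suc d) v (x(d := R)) - inner_n (Suc d) v (y(d := R))\<bar>"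
      unfolding neuron_def using xy R v by (intro abs_ridge_diff_le abs_inner_lift_le) auto
    ultimately show ?thesis
      by linarith
  qed
  have "f x - f y = signed_integral ?M \<mu> (\<lambda>v. neuron \<alpha> d R x v - neuron \<alpha> d R y v)"
    using \<mu>(1) x y xy R
    by (subst signed_integral_diff[where c = "sqrt 2 ^ \<alpha>"])
      (auto simp: represents_def space_weight_sphere intro!: neuron_measurable abs_neuron_le)
  also have "\<bar>\<dots>\<bar> \<le> ridge_lip \<alpha> * (real d * (h / R)) * enn2real (total_variation ?M \<mu> (space ?M))"
    using \<mu>(1) h(2) R
    by (intro abs_signed_integral_le borel_measurable_diff neuron_measurable diff)
      (auto simp: represents_def ridge_lip_nonneg)
  also have "\<dots> \<le> ridge_lip \<alpha> * (real d * (h / R)) * (2 * \<delta>)"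
    using \<mu>(2) h(2) R by (intro mult_left_mono) (auto simp: ridge_lip_nonneg)
  finally show ?thesis
    by (simp add: mult.commute)
qed

text \<open>The Arzela-Ascoli argument with \<epsilon>/3 each for moving f from x to a nearby net
  point y, for exchanging f and g at y, and for moving g back.\<close>

lemma F1_ball_finite_net:
  assumes \<delta>: "0 < \<delta>" and R: "0 < R" and \<epsilon>: "0 < \<epsilon>"
  obtains T where "finite T" "T \<subseteq> F1_ball \<alpha> d R \<delta>"
    "\<And>f. f \<in> F1_ball \<alpha> d R \<delta> \<Longrightarrow> \<exists>g\<in>T. \<forall>x\<in>ball_n d R. \<bar>f x - g x\<bar> \<le> \<epsilon>"
proof -
  define \<kappa> where "\<kappa> = 2 * \<delta> * ridge_lip \<alpha> * real d / R"
  have \<kappa>: "0 \<le> \<kappa>"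
    using \<delta> R by (simp add: \<kappa>_def ridge_lip_nonneg)
  \<comment> \<open>\<open>\<kappa> * h\<close> is the oscillation at coordinate distance h; the
    summand 1 covers \<kappa> = 0.\<close>
  define h where "h = \<epsilon> / 3 / (\<kappa> + 1)"
  have ne: "\<kappa> + 1 \<noteq> 0"
    using \<kappa> by linarith
  have h: "0 < h"
    using \<epsilon> \<kappa> by (simp add: h_def)
  have "h * (\<kappa> + 1) = \<epsilon> / 3"
    using iffD1[OF nonzero_eq_divide_eq[OF ne] h_def] .
  then have \<kappa>h: "\<kappa> * h \<le> \<epsilon> / 3"
    using h by (simp add: algebra_simps)
  have "\<exists>X. finite X \<and> X \<subseteq> ball_n d R \<and> (\<forall>x\<in>ball_n d R. \<exists>y\<in>X. \<forall>i\<in>{..<d}. \<bar>x i - y i\<bar> \<le> h)"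
  proof (rule finite_net_of_bounded_functions)
    fix x i assume "x \<in> ball_n d R" "i \<in> {..<d}"
    then show "\<bar>x i\<bar> \<le> R"
      using abs_le_norm_n[of i d x] by (auto simp: ball_n_def)
  qed (use h in auto)
  then obtain X where X: "finite X" "X \<subseteq> ball_n d R"
      "\<forall>x\<in>ball_n d R. \<exists>y\<in>X. \<forall>i\<in>{..<d}. \<bar>x i - y i\<bar> \<le> h"
    by blast
  have "\<exists>T. finite T \<and> T \<subseteq> F1_ball \<alpha> d R \<delta> \<and>
      (\<forall>f\<in>F1_ball \<alpha> d R \<delta>. \<exists>g\<in>T. \<forall>x\<in>X. \<bar>f x - g x\<bar> \<le> \<epsilon> / 3)"
  proof (rule finite_net_of_bounded_functions[OF X(1)])
    fix f x assume "f \<in> F1_ball \<alpha> d R \<delta>" "x \<in> X"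
    then show "\<bar>f x\<bar> \<le> sqrt 2 ^ \<alpha> * \<delta>"
      using X(2) \<delta> R by (intro F1_ball_abs_le[of f \<alpha> d R \<delta> x]) auto
  qed (use \<epsilon> in auto)
  then obtain T where T: "finite T" "T \<subseteq> F1_ball \<alpha> d R \<delta>"
      "\<forall>f\<in>F1_ball \<alpha> d R \<delta>. \<exists>g\<in>T. \<forall>x\<in>X. \<bar>f x - g x\<bar> \<le> \<epsilon> / 3"
    by blast
  have "\<exists>g\<in>T. \<forall>x\<in>ball_n d R. \<bar>f x - g x\<bar> \<le> \<epsilon>" if f: "f \<in> F1_ball \<alpha> d R \<delta>" for f
  proof -
    obtain g where g: "g \<in> T" "\<forall>x\<in>X. \<bar>f x - g x\<bar> \<le> \<epsilon> / 3"
      using T(3) f by blast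
    have "\<bar>f x - g x\<bar> \<le> \<epsilon>" if x: "x \<in> ball_n d R" for x
    proof -
      obtain y where y: "y \<in> X" "\<And>i. i < d \<Longrightarrow> \<bar>x i - y i\<bar> \<le> h"
        using X(3) x by blast
      have "\<bar>k x - k y\<bar> \<le> \<epsilon> / 3" if "k \<in> F1_ball \<alpha> d R \<delta>" for k
      proof -
        have "\<bar>k x - k y\<bar> \<le> 2 * \<delta> * (ridge_lip \<alpha> * (real d * (h / R)))"
          using X(2) y h by (intro F1_ball_modulus[OF that \<delta> R x]) auto
        also have "\<dots> = \<kappa> * h"
          by (simp add: \<kappa>_def)
        finally show ?thesis
          using \<kappa>h by linarith
      qed
      then have "\<bar>f x - f y\<bar> \<le> \<epsilon> / 3" "\<bar>g x - g y\<bar> \<le> \<epsilon> / 3"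
        using f g(1) T(2) by auto
      moreover have "\<bar>f y - g y\<bar> \<le> \<epsilon> / 3"
        using g(2) y(1) by blast
      ultimately show ?thesis
        by linarith
    qed
    with g(1) show ?thesis
      by blast
  qed
  with T(1,2) show thesis
    by (rule that)
qed

text \<open>On the ball, f is a difference of parameter integrals of a jointly measurable function;
  outside it is the constant \<open>undefined\<close>, by extensionality.\<close>

lemma F1_measurable:
  assumes "f \<in> F1 \<alpha> d R"
  shows "f \<in> borel_measurable (euclid d)"
proof -
  let ?M = "weight_sphere d R"
  obtain \<mu> where \<mu>: "represents \<alpha> d R \<mu> f"
    using assms by (auto simp: F1_def)
  have "(\<lambda>x. signed_integral ?M \<mu> (neuron \<alpha> d R x)) \<in> borel_measurable (euclid d)"
    unfolding signed_integral_def
  proof (intro borel_measurable_diff)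
    have "(\<lambda>x. \<integral>v. neuron \<alpha> d R x v \<partial>M') \<in> borel_measurable (euclid d)"
      if "finite_measure M'" "sets M' = sets ?M" for M'
    proof -
      interpret finite_measure M' by fact
      show ?thesis
      proof (rule borel_measurable_lebesgue_integral)
        show "(\<lambda>(x, v). neuron \<alpha> d R x v) \<in> borel_measurable (euclid d \<Otimes>\<^sub>M M')"
          using neuron_measurable2[of \<alpha> d R]
            measurable_cong_sets[OF sets_pair_measure_cong[OF refl that(2)] refl] by blast
      qed
    qed
    then show "(\<lambda>x. \<integral>v. neuron \<alpha> d R x v \<partial>pos_variation ?M \<mu>) \<in> borel_measurable (euclid d)"
      "(\<lambda>x. \<integral>v. neuron \<alpha> d R x v \<partial>neg_variation ?M \<mu>) \<in> borel_measurable (euclid d)"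
      by (simp_all add: finite_measure_variation)
  qed
  then have "(\<lambda>x. if x \<in> ball_n d R then signed_integral ?M \<mu> (neuron \<alpha> d R x) else undefined)
      \<in> borel_measurable (euclid d)"
    by measurable
  moreover have "f = (\<lambda>x. if x \<in> ball_n d R then signed_integral ?M \<mu> (neuron \<alpha> d R x) else undefined)"
    using \<mu> by (auto simp: represents_def extensional_def)
  ultimately show ?thesis
    by simp
qed


subsection \<open>Excess risk of the empirical minimizer\<close>

text \<open>
  The losses \<open>loss y 0\<close> need not be bounded below, so the argument uses the increments
  \<open>loss y (f x) - loss y 0\<close>, which are bounded. If \<open>loss y 0\<close> is not integrable, then every
  risk in question is the junk value 0.
\<close>

definition loss_increment ::
    "nat \<Rightarrow> real \<Rightarrow> ('y \<Rightarrow> real \<Rightarrow> real) \<Rightarrow> ((nat \<Rightarrow> real) \<Rightarrow> real) \<Rightarrow> (nat \<Rightarrow> real) \<times> 'y \<Rightarrow> real" where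
  "loss_increment d R loss f p =
     (if fst p \<in> ball_n d R then loss (snd p) (f (fst p)) - loss (snd p) 0 else 0)"

section \<open>Measurability and size of the loss increments\<close>

lemma sample_space:
  assumes "sets D = sets (euclid d \<Otimes>\<^sub>M N)" "p \<in> space D"
  shows "fst p \<in> {..<d} \<rightarrow>\<^sub>E UNIV" "snd p \<in> space N"
proof -
  have "p \<in> space (euclid d) \<times> space N"
    using assms(2) sets_eq_imp_space_eq[OF assms(1)] by (simp only: space_pair_measure)
  then show "fst p \<in> {..<d} \<rightarrow>\<^sub>E UNIV" "snd p \<in> space N"
    by (simp_all only: mem_Times_iff euclid_def space_PiM space_borel)
qed

lemma loss_measurable:
  assumes sets: "sets D = sets (euclid d \<Otimes>\<^sub>M N)"
    and loss: "(\<lambda>(y, u). loss y u) \<in> borel_measurable (N \<Otimes>\<^sub>M borel)"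
    and f: "f \<in> borel_measurable (euclid d)"
  shows "(\<lambda>p. loss (snd p) (f (fst p)) :: real) \<in> borel_measurable D"
proof -
  have "(\<lambda>p. (snd p, f (fst p))) \<in> measurable (euclid d \<Otimes>\<^sub>M N) (N \<Otimes>\<^sub>M borel)"
    using measurable_compose[OF measurable_fst f] by (intro measurable_Pair) auto
  from measurable_compose[OF this loss] show ?thesis
    by (simp add: measurable_cong_sets[OF sets refl])
qed

lemma loss_increment_measurable:
  assumes sets: "sets D = sets (euclid d \<Otimes>\<^sub>M N)"
    and loss: "(\<lambda>(y, u). loss y u) \<in> borel_measurable (N \<Otimes>\<^sub>M borel)"
    and f: "f \<in> borel_measurable (euclid d)"
  shows "loss_increment d R loss f \<in> borel_measurable D"
proof -
  have "(\<lambda>p. loss (snd p) (f (fst p))) \<in> borel_measurable D"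
    "(\<lambda>p. loss (snd p) 0) \<in> borel_measurable D"
    using loss_measurable[OF sets loss f] loss_measurable[OF sets loss, of "\<lambda>_. 0"] by auto
  moreover have "{p \<in> space D. fst p \<in> ball_n d R} \<in> sets D"
  proof -
    have "fst \<in> measurable D (euclid d)"
      by (simp add: measurable_cong_sets[OF sets refl])
    from measurable_sets[OF this ball_n_sets[of d R]] show ?thesis
      by (simp add: vimage_def Int_def conj_commute)
  qed
  ultimately show ?thesis
    unfolding loss_increment_def[abs_def] by (intro measurable_If borel_measurable_diff) auto
qed

lemma loss_increment_diff_le:
  assumes lip: "\<And>y. y \<in> space N \<Longrightarrow> G-lipschitz_on {u. \<bar>u\<bar> \<le> sqrt 2 ^ \<alpha> * \<delta>} (loss y)"
    and G: "0 \<le> G" and \<delta>: "0 < \<delta>" and R: "0 < R"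
    and f: "f \<in> F1_ball \<alpha> d R \<delta>" and g: "g \<in> F1_ball \<alpha> d R \<delta>"
    and p: "fst p \<in> ball_n d R" "snd p \<in> space N"
  shows "\<bar>loss_increment d R loss f p - loss_increment d R loss g p\<bar> \<le> G * \<bar>f (fst p) - g (fst p)\<bar>"
proof -
  have "\<bar>k (fst p)\<bar> \<le> sqrt 2 ^ \<alpha> * \<delta>" if "k \<in> F1_ball \<alpha> d R \<delta>" for k
    using F1_ball_abs_le[OF that _ R p(1)] \<delta> by simp
  then show ?thesis
    using lipschitz_onD[OF lip[OF p(2)], of "f (fst p)" "g (fst p)"] f g p(1)
    by (simp add: loss_increment_def dist_real_def)
qed

text \<open>The bound holds at every sample point, since the increment is set to 0 when the input
  lies outside the ball; \<open>symmetrization\<close> asks for a bound everywhere, not just almost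
  everywhere.\<close>

lemma loss_increment_abs_le:
  assumes lip: "\<And>y. y \<in> space N \<Longrightarrow> G-lipschitz_on {u. \<bar>u\<bar> \<le> sqrt 2 ^ \<alpha> * \<delta>} (loss y)"
    and G: "0 \<le> G" and \<delta>: "0 < \<delta>" and R: "0 < R"
    and f: "f \<in> F1_ball \<alpha> d R \<delta>" and p: "snd p \<in> space N"
  shows "\<bar>loss_increment d R loss f p\<bar> \<le> G * (sqrt 2 ^ \<alpha> * \<delta>)"
proof (cases "fst p \<in> ball_n d R")
  case True
  then have "\<bar>f (fst p)\<bar> \<le> sqrt 2 ^ \<alpha> * \<delta>"
    using F1_ball_abs_le[OF f _ R] \<delta> by simp
  moreover from this have "\<bar>loss (snd p) (f (fst p)) - loss (snd p) 0\<bar> \<le> G * \<bar>f (fst p)\<bar>"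
    using lipschitz_onD[OF lip[OF p], of "f (fst p)" 0] \<delta> by (simp add: dist_real_def)
  ultimately show ?thesis
    using True G by (auto simp: loss_increment_def intro: order.trans mult_left_mono)
qed (use G \<delta> in \<open>simp add: loss_increment_def\<close>)

lemma sign_avg_loss_increment:
  assumes \<alpha>: "1 \<le> \<alpha>"
    and lip: "\<And>y. y \<in> space N \<Longrightarrow> G-lipschitz_on {u. \<bar>u\<bar> \<le> sqrt 2 ^ \<alpha> * \<delta>} (loss y)"
    and G: "0 \<le> G" and \<delta>: "0 < \<delta>" and R: "0 < R"
    and T: "finite T" "T \<noteq> {}" "T \<subseteq> F1_ball \<alpha> d R \<delta>"
    and s: "\<And>i. i < n \<Longrightarrow> fst (s i) \<in> ball_n d R" "\<And>i. i < n \<Longrightarrow> snd (s i) \<in> space N"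
  shows "sign_avg n (\<lambda>\<epsilon>. SUP f\<in>T. \<Sum>i<n. \<epsilon> i * loss_increment d R loss f (s i)) \<le>
    G * (4 * \<delta> * (ridge_lip \<alpha> * sqrt 2 * sqrt n))"
proof -
  have "sign_avg n (\<lambda>\<epsilon>. SUP f\<in>T. \<Sum>i<n. \<epsilon> i * loss_increment d R loss f (s i)) \<le>
      sign_avg n (\<lambda>\<epsilon>. SUP f\<in>T. \<Sum>i<n. \<epsilon> i * (G * f (fst (s i))))"
  proof (rule sign_avg_contraction[OF T(2)])
    fix i f g assume "i < n" "f \<in> T" "g \<in> T"
    then have "\<bar>loss_increment d R loss f (s i) - loss_increment d R loss g (s i)\<bar> \<le>
        G * \<bar>f (fst (s i)) - g (fst (s i))\<bar>"
      using T(3) s by (intro loss_increment_diff_le[OF lip G \<delta> R]) auto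
    then show "\<bar>loss_increment d R loss f (s i) - loss_increment d R loss g (s i)\<bar> \<le>
        \<bar>G * f (fst (s i)) - G * g (fst (s i))\<bar>"
      using G by (simp add: abs_mult flip: right_diff_distrib)
  qed (use T(1) in \<open>auto intro: finite_imp_bounded\<close>)
  also have "\<dots> \<le> sign_avg n (\<lambda>\<epsilon>. G * (SUP f\<in>T. \<Sum>i<n. \<epsilon> i * f (fst (s i))))"
  proof (intro sign_avg_mono cSUP_least[OF T(2)])
    fix \<epsilon> f assume f: "f \<in> T"
    have "(\<Sum>i<n. \<epsilon> i * (G * f (fst (s i)))) = G * (\<Sum>i<n. \<epsilon> i * f (fst (s i)))"
      by (simp add: sum_distrib_left ac_simps)
    also have "\<dots> \<le> G * (SUP f\<in>T. \<Sum>i<n. \<epsilon> i * f (fst (s i)))"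
      using f T(1) G by (intro mult_left_mono cSUP_upper) auto
    finally show "(\<Sum>i<n. \<epsilon> i * (G * f (fst (s i)))) \<le> G * (SUP f\<in>T. \<Sum>i<n. \<epsilon> i * f (fst (s i)))" .
  qed
  also have "\<dots> \<le> G * (4 * \<delta> * (ridge_lip \<alpha> * sqrt 2 * sqrt n))"
    unfolding sign_avg_cmult
    using sign_avg_F1_ball[OF \<alpha> R \<delta>, of n "\<lambda>i. fst (s i)" d T] T s G by (intro mult_left_mono) auto
  finally show ?thesis .
qed

text \<open>The increment is bounded, so the loss at f is integrable exactly if the loss at 0 is.
  The case is thus the same for every f in the ball, and risks can be compared within each
  case.\<close>

lemma risk_eq_increment:
  assumes sets: "sets D = sets (euclid d \<Otimes>\<^sub>M N)" and D: "prob_space D"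
    and loss: "(\<lambda>(y, u). loss y u) \<in> borel_measurable (N \<Otimes>\<^sub>M borel)"
    and lip: "\<And>y. y \<in> space N \<Longrightarrow> G-lipschitz_on {u. \<bar>u\<bar> \<le> sqrt 2 ^ \<alpha> * \<delta>} (loss y)"
    and G: "0 \<le> G" and \<delta>: "0 < \<delta>" and R: "0 < R"
    and ball: "AE p in D. fst p \<in> ball_n d R"
    and f: "f \<in> F1_ball \<alpha> d R \<delta>"
  shows "risk D loss f = (if integrable D (\<lambda>p. loss (snd p) 0)
    then (\<integral>p. loss (snd p) 0 \<partial>D) + (\<integral>p. loss_increment d R loss f p \<partial>D) else 0)"
proof -
  interpret prob_space D by fact
  have f_ms: "f \<in> borel_measurable (euclid d)"
    using f by (auto simp: F1_ball_def intro: F1_measurable)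
  note ms = loss_measurable[OF sets loss f_ms] loss_measurable[OF sets loss, of "\<lambda>_. 0"]
    loss_increment_measurable[OF sets loss f_ms, of R]
  note sp = sample_space(2)[OF sets]
  have int_inc: "integrable D (loss_increment d R loss f)"
    using ms(3) loss_increment_abs_le[where loss = loss and f = f, OF lip G \<delta> R f] sp
    by (intro integrable_const_bound[where B = "G * (sqrt 2 ^ \<alpha> * \<delta>)"] AE_I2) auto
  have AE: "AE p in D. loss (snd p) (f (fst p)) = loss (snd p) 0 + loss_increment d R loss f p"
    using ball by eventually_elim (simp add: loss_increment_def)
  show ?thesis
  proof (cases "integrable D (\<lambda>p. loss (snd p) 0)")
    case True
    have "risk D loss f = (\<integral>p. loss (snd p) 0 + loss_increment d R loss f p \<partial>D)"
      unfolding risk_def using ms by (intro integral_cong_AE AE borel_measurable_add) auto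
    with True int_inc show ?thesis
      by simp
  next
    case False
    have "\<not> integrable D (\<lambda>p. loss (snd p) (f (fst p)))"
    proof
      assume "integrable D (\<lambda>p. loss (snd p) (f (fst p)))"
      from Bochner_Integration.integrable_diff[OF this int_inc]
      have "integrable D (\<lambda>p. loss (snd p) 0)"
        by (rule integrable_cong_AE_imp) (use ms AE in auto)
      with False show False ..
    qed
    with False show ?thesis
      by (simp add: risk_def not_integrable_integral_eq)
  qed
qed

lemma empirical_minimizer_increment:
  assumes n: "1 \<le> n" and s: "\<And>i. i < n \<Longrightarrow> fst (s i) \<in> ball_n d R"
    and f: "empirical_minimizer n s loss F f" and g: "g \<in> F"
  shows "(\<Sum>i<n. loss_increment d R loss f (s i)) \<le> (\<Sum>i<n. loss_increment d R loss g (s i))"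
proof -
  have "empirical_risk n s loss f \<le> empirical_risk n s loss g"
    using f g by (simp add: empirical_minimizer_def)
  then have "(\<Sum>i<n. loss (snd (s i)) (f (fst (s i)))) \<le> (\<Sum>i<n. loss (snd (s i)) (g (fst (s i))))"
    using n by (simp add: empirical_risk_def divide_le_cancel)
  moreover have "(\<Sum>i<n. loss_increment d R loss k (s i)) =
      (\<Sum>i<n. loss (snd (s i)) (k (fst (s i)))) - (\<Sum>i<n. loss (snd (s i)) 0)" for k
    using s by (simp add: loss_increment_def flip: sum_subtractf)
  ultimately show ?thesis
    by simp
qed

text \<open>The comparison function g is fixed, so the mean of its empirical sum is exact and only
  the deviation of \<open>fhat s\<close> has to be controlled uniformly. The factor 8 is the 2 of
  symmetrization times the 4 of \<open>sign_avg_F1_ball\<close>.\<close>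

lemma excess_risk_bound:
  fixes n :: nat
  assumes \<alpha>: "1 \<le> \<alpha>" and n: "1 \<le> n" and R: "0 < R" and G: "0 \<le> G" and \<delta>: "0 < \<delta>" and \<epsilon>: "0 < \<epsilon>"
    and D: "prob_space D" and sets: "sets D = sets (euclid d \<Otimes>\<^sub>M N)"
    and loss: "(\<lambda>(y, u). loss y u) \<in> borel_measurable (N \<Otimes>\<^sub>M borel)"
    and norm: "AE p in D. norm_n d (fst p) \<le> R"
    and lip: "\<And>y. y \<in> space N \<Longrightarrow> G-lipschitz_on {u. \<bar>u\<bar> \<le> sqrt 2 ^ \<alpha> * \<delta>} (loss y)"
    and fhat: "AE s in (\<Pi>\<^sub>M i\<in>{..<n}. D). empirical_minimizer n s loss (F1_ball \<alpha> d R \<delta>) (fhat s)"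
    and ms: "(\<lambda>s. risk D loss (fhat s)) \<in> borel_measurable (\<Pi>\<^sub>M i\<in>{..<n}. D)"
    and g: "g \<in> F1_ball \<alpha> d R \<delta>"
  shows "(\<integral>s. risk D loss (fhat s) \<partial>(\<Pi>\<^sub>M i\<in>{..<n}. D)) - risk D loss g \<le>
    8 * sqrt 2 * ridge_lip \<alpha> * G * \<delta> / sqrt n + 2 * G * \<epsilon>"
proof -
  interpret D: prob_space D by fact
  define P where "P = (\<Pi>\<^sub>M i\<in>{..<n}. D)"
  interpret P: prob_space P
    unfolding P_def by (intro prob_space_PiM D)
  define F where "F = F1_ball \<alpha> d R \<delta>"
  define h where "h = loss_increment d R loss"
  define B where "B = G * (sqrt 2 ^ \<alpha> * \<delta>)"
  note spD = sample_space[OF sets]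
  have ball: "AE p in D. fst p \<in> ball_n d R"
    using norm AE_space by eventually_elim (simp add: ball_n_def spD(1))
  have risk_eq: "risk D loss f = (if integrable D (\<lambda>p. loss (snd p) 0)
      then (\<integral>p. loss (snd p) 0 \<partial>D) + (\<integral>p. loss_increment d R loss f p \<partial>D) else 0)"
    if "f \<in> F1_ball \<alpha> d R \<delta>" for f
    by (rule risk_eq_increment[OF sets D loss lip G \<delta> R ball that])
  have h_ms: "h f \<in> borel_measurable D" if "f \<in> F" for f
    using that unfolding h_def F_def F1_ball_def
    by (auto intro!: loss_increment_measurable[OF sets loss] F1_measurable)
  have h_le: "\<bar>h f p\<bar> \<le> B" if "f \<in> F" "p \<in> space D" for f p
    unfolding h_def B_def using that spD(2)[OF that(2)] by (intro loss_increment_abs_le[OF lip G \<delta> R]) (auto simp: F_def)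
  have h_int: "integrable D (h f)" if "f \<in> F" for f
    using h_ms[OF that] h_le[OF that] by (intro D.integrable_const_bound[where B = B] AE_I2) auto
  have h_near: "\<bar>h f p - h k p\<bar> \<le> G * \<epsilon>"
    if "f \<in> F" "k \<in> F" "\<forall>x\<in>ball_n d R. \<bar>f x - k x\<bar> \<le> \<epsilon>" "p \<in> space D" for f k p
  proof (cases "fst p \<in> ball_n d R")
    case True
    have "\<bar>h f p - h k p\<bar> \<le> G * \<bar>f (fst p) - k (fst p)\<bar>"
      unfolding h_def using that(1,2) spD(2)[OF that(4)] True
      by (intro loss_increment_diff_le[OF lip G \<delta> R]) (auto simp: F_def)
    also have "\<dots> \<le> G * \<epsilon>"
      using G that(3) True by (intro mult_left_mono) auto
    finally show ?thesis .
  qed (use G \<epsilon> in \<open>simp add: h_def loss_increment_def\<close>)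
  have good: "AE s in P. \<forall>i<n. fst (s i) \<in> ball_n d R"
  proof -
    have "AE s in P. fst (s i) \<in> ball_n d R" if "i < n" for i
      unfolding P_def using that D ball by (intro AE_PiM_component) auto
    then have "AE s in P. \<forall>i\<in>{..<n}. fst (s i) \<in> ball_n d R"
      by (intro AE_finite_allI) auto
    then show ?thesis
      by eventually_elim simp
  qed
  have spP: "s i \<in> space D" if "s \<in> space P" "i < n" for s i
    using that by (auto simp: P_def space_PiM PiE_def Pi_def)
  have fhat_F: "AE s in P. fhat s \<in> F"
    using fhat unfolding P_def[symmetric] F_def[symmetric]
    by eventually_elim (simp add: empirical_minimizer_def)
  show ?thesis
  proof (cases "integrable D (\<lambda>p. loss (snd p) 0)")
    case False
    have "AE s in P. risk D loss (fhat s) = 0"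
      using fhat_F by eventually_elim (use risk_eq False in \<open>simp add: F_def\<close>)
    then have "(\<integral>s. risk D loss (fhat s) \<partial>P) = 0"
      by (rule integral_eq_zero_AE)
    moreover have "risk D loss g = 0"
      using risk_eq[OF g] False by simp
    ultimately show ?thesis
      using G \<delta> \<epsilon> by (simp add: P_def ridge_lip_nonneg)
  next
    case True
    define E0 where "E0 = (\<integral>p. loss (snd p) 0 \<partial>D)"
    have risk_F: "risk D loss f = E0 + (\<integral>p. h f p \<partial>D)" if "f \<in> F" for f
      using risk_eq[of f] True that by (simp add: F_def E0_def h_def)
    obtain T where T: "finite T" "T \<subseteq> F"
      "\<And>f. f \<in> F \<Longrightarrow> \<exists>k\<in>T. \<forall>x\<in>ball_n d R. \<bar>f x - k x\<bar> \<le> \<epsilon>"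
      unfolding F_def using F1_ball_finite_net[OF \<delta> R \<epsilon>, of \<alpha> d] by metis
    have T0: "T \<noteq> {}"
      using T(3)[of g] g by (auto simp: F_def)
    define U where "U = (\<lambda>s. SUP f\<in>T. real n * (\<integral>p. h f p \<partial>D) - (\<Sum>i<n. h f (s i)))"
    define K where "K = G * (4 * \<delta> * (ridge_lip \<alpha> * sqrt 2 * sqrt n))"
    have U: "(\<integral>s. U s \<partial>P) \<le> 2 * K"
      unfolding U_def P_def
    proof (rule symmetrization[OF D T(1) T0, where B = B])
      show "AE s in (\<Pi>\<^sub>M i\<in>{..<n}. D). sign_avg n (\<lambda>\<epsilon>. SUP f\<in>T. \<Sum>i<n. \<epsilon> i * h f (s i)) \<le> K"
        using good AE_space unfolding P_def[symmetric]
      proof eventually_elim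
        case (elim s)
        then show ?case
          unfolding h_def K_def using T(2) spD(2)[OF spP]
          by (intro sign_avg_loss_increment[OF \<alpha> lip G \<delta> R T(1) T0]) (auto simp: F_def)
      qed
    qed (use T(2) h_ms h_le in auto)
    have h_comp: "(\<lambda>s. h f (s i)) \<in> borel_measurable P" if "f \<in> F" "i < n" for f i
      unfolding P_def using that h_ms by (intro measurable_PiM_eval) auto
    have Eh_le: "\<bar>\<integral>p. h f p \<partial>D\<bar> \<le> B" if "f \<in> F" for f
      using D.abs_integral_le[OF h_ms[OF that] h_le[OF that]] by (simp add: D.prob_space)
    have sum_le: "\<bar>\<Sum>i<n. h f (s i)\<bar> \<le> (\<Sum>i<n. B)" if "f \<in> F" "s \<in> space P" for f s
      using that by (intro order.trans[OF sum_abs] sum_mono) (auto intro!: h_le spP)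
    have U_int: "integrable P U"
      unfolding U_def
    proof (rule P.integrable_SUP_bounded[OF T(1) T0])
      fix f s assume fs: "f \<in> T" "s \<in> space P"
      then have "f \<in> F"
        using T(2) by auto
      have "\<bar>real n * (\<integral>p. h f p \<partial>D)\<bar> \<le> real n * B"
        using Eh_le[OF \<open>f \<in> F\<close>] by (simp add: abs_mult mult_left_mono)
      with sum_le[OF \<open>f \<in> F\<close> fs(2)]
      show "\<bar>real n * (\<integral>p. h f p \<partial>D) - (\<Sum>i<n. h f (s i))\<bar> \<le> real n * B + (\<Sum>i<n. B)"
        by linarith
    qed (use T(2) in \<open>auto intro!: borel_measurable_diff borel_measurable_sum h_comp\<close>)
    have g_int: "integrable P (\<lambda>s. h g (s i))" if "i < n" for i
      using that g by (intro P.integrable_const_bound[where B = B] h_comp AE_I2) (auto simp: F_def intro!: h_le spP)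
    have g_mean: "(\<integral>s. h g (s i) \<partial>P) = (\<integral>p. h g p \<partial>D)" if "i < n" for i
      unfolding P_def using that g h_ms by (intro integral_PiM_eval D) (auto simp: F_def)
    have risk_int: "integrable P (\<lambda>s. risk D loss (fhat s))"
    proof (rule P.integrable_const_bound)
      show "AE s in P. norm (risk D loss (fhat s)) \<le> \<bar>E0\<bar> + B"
        using fhat_F
      proof eventually_elim
        case (elim s)
        then show ?case
          using risk_F[OF elim] Eh_le[OF elim] by simp
      qed
      show "(\<lambda>s. risk D loss (fhat s)) \<in> borel_measurable P"
        using ms by (simp add: P_def)
    qed
    \<comment> \<open>\<open>fhat s\<close> varies with s through an infinite class, so it is
      replaced by a net element k twice, in the true mean and in the empirical sum, at a cost of n G
      \<epsilon> each time.\<close>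
    have main: "AE s in P. real n * risk D loss (fhat s) \<le>
        real n * E0 + U s + 2 * real n * G * \<epsilon> + (\<Sum>i<n. h g (s i))"
      using fhat[folded P_def F_def] good fhat_F AE_space
    proof eventually_elim
      case (elim s)
      obtain k where k: "k \<in> T" "\<forall>x\<in>ball_n d R. \<bar>fhat s x - k x\<bar> \<le> \<epsilon>"
        using T(3)[OF elim(3)] by blast
      have kF: "k \<in> F"
        using k(1) T(2) by auto
      have near: "\<bar>h (fhat s) p - h k p\<bar> \<le> G * \<epsilon>" if "p \<in> space D" for p
        using h_near[OF elim(3) kF k(2) that] .
      have "(\<integral>p. h (fhat s) p \<partial>D) \<le> (\<integral>p. h k p + G * \<epsilon> \<partial>D)"
      proof (rule integral_mono)
        show "h (fhat s) p \<le> h k p + G * \<epsilon>" if "p \<in> space D" for p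
          using near[OF that] by linarith
      qed (use h_int elim(3) kF in auto)
      also have "\<dots> = (\<integral>p. h k p \<partial>D) + G * \<epsilon>"
        using h_int[OF kF] by (simp add: D.prob_space)
      finally have "real n * (\<integral>p. h (fhat s) p \<partial>D) \<le> real n * ((\<integral>p. h k p \<partial>D) + G * \<epsilon>)"
        by (intro mult_left_mono) auto
      moreover have "real n * (\<integral>p. h k p \<partial>D) - (\<Sum>i<n. h k (s i)) \<le> U s"
        unfolding U_def using k(1) T(1) by (intro cSUP_upper) auto
      moreover have "(\<Sum>i<n. h k (s i)) \<le> (\<Sum>i<n. h (fhat s) (s i) + G * \<epsilon>)"
      proof (rule sum_mono)
        fix i assume "i \<in> {..<n}"
        then show "h k (s i) \<le> h (fhat s) (s i) + G * \<epsilon>"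
          using near[of "s i"] spP[OF elim(4), of i] by (simp add: abs_le_iff)
      qed
      moreover have "(\<Sum>i<n. h (fhat s) (s i)) \<le> (\<Sum>i<n. h g (s i))"
        unfolding h_def using elim(2) g
        by (intro empirical_minimizer_increment[OF n _ elim(1)]) (auto simp: F_def)
      ultimately show ?case
        by (simp add: risk_F[OF elim(3)] sum.distrib algebra_simps)
    qed
    have "(\<integral>s. real n * risk D loss (fhat s) \<partial>P) \<le>
        (\<integral>s. real n * E0 + U s + 2 * real n * G * \<epsilon> + (\<Sum>i<n. h g (s i)) \<partial>P)"
      using risk_int U_int g_int
      by (intro integral_mono_AE main Bochner_Integration.integrable_add
          Bochner_Integration.integrable_sum P.integrable_const integrable_mult_right) auto
    also have "\<dots> = real n * E0 + (\<integral>s. U s \<partial>P) + 2 * real n * G * \<epsilon> + real n * (\<integral>p. h g p \<partial>D)"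
    proof -
      have "integrable P (\<lambda>s. \<Sum>i<n. h g (s i))"
        using g_int by (intro Bochner_Integration.integrable_sum) auto
      moreover have "(\<integral>s. (\<Sum>i<n. h g (s i)) \<partial>P) = real n * (\<integral>p. h g p \<partial>D)"
        using g_int by (subst Bochner_Integration.integral_sum) (auto simp: g_mean)
      ultimately show ?thesis
        using U_int by (simp add: P.prob_space)
    qed
    also have "\<dots> \<le> real n * risk D loss g + 2 * K + 2 * real n * G * \<epsilon>"
      using U risk_F[of g] g by (simp add: F_def algebra_simps)
    finally have "real n * ((\<integral>s. risk D loss (fhat s) \<partial>P) - risk D loss g) \<le> 2 * K + 2 * real n * G * \<epsilon>"
      by (simp add: algebra_simps)
    then have "(\<integral>s. risk D loss (fhat s) \<partial>P) - risk D loss g \<le> (2 * K + 2 * real n * G * \<epsilon>) / real n"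
      using n by (simp add: pos_le_divide_eq mult.commute)
    also have "\<dots> = 8 * sqrt 2 * ridge_lip \<alpha> * G * \<delta> * (sqrt n / real n) + 2 * G * \<epsilon>"
      using n by (simp add: K_def add_divide_distrib)
    also have "sqrt n / real n = 1 / sqrt n"
      using n by (simp add: field_simps)
    finally show ?thesis
      by (simp add: P_def)
  qed
qed

theorem mainTheorem6:
  fixes \<alpha> :: nat
  assumes "1 \<le> \<alpha>"
  shows "\<exists>c C :: real. 0 < c \<and> 0 < C \<and>
    (\<forall>(d :: nat) (n :: nat) (R :: real) (\<eta> :: real) (G :: real) (\<delta> :: real)
        (N :: 'y measure) (D :: ((nat \<Rightarrow> real) \<times> 'y) measure) (loss :: 'y \<Rightarrow> real \<Rightarrow> real)
        (fhat :: (nat \<Rightarrow> (nat \<Rightarrow> real) \<times> 'y) \<Rightarrow> (nat \<Rightarrow> real) \<Rightarrow> real).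
      1 \<le> d \<longrightarrow> 1 \<le> n \<longrightarrow> 0 < R \<longrightarrow> 0 < \<eta> \<longrightarrow> 0 < G \<longrightarrow>
      \<delta> = c * R * \<eta> \<longrightarrow>
      prob_space D \<longrightarrow> sets D = sets (euclid d \<Otimes>\<^sub>M N) \<longrightarrow>
      (\<lambda>(y, u). loss y u) \<in> borel_measurable (N \<Otimes>\<^sub>M borel) \<longrightarrow>
      (AE p in D. norm_n d (fst p) \<le> R) \<longrightarrow>
      assumption_L \<alpha> N D loss G \<delta> \<longrightarrow>
      (AE s in (\<Pi>\<^sub>M i\<in>{..<n}. D). empirical_minimizer n s loss (F1_ball \<alpha> d R \<delta>) (fhat s)) \<longrightarrow>
      (\<lambda>s. risk D loss (fhat s)) \<in> borel_measurable (\<Pi>\<^sub>M i\<in>{..<n}. D) \<longrightarrow>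
      (\<forall>w\<in>{..<d} \<rightarrow>\<^sub>E UNIV. \<forall>b. norm_n d w \<le> \<eta> \<longrightarrow> \<bar>b\<bar> \<le> R * \<eta> \<longrightarrow>
        (\<integral>s. risk D loss (fhat s) \<partial>(\<Pi>\<^sub>M i\<in>{..<n}. D)) - risk D loss (\<lambda>x. inner_n d w x + b)
          \<le> C * (G * R * \<eta> / sqrt (real n))))"
proof -
  obtain c where c: "0 < c" and affine: "\<And>d R \<eta> w b. 1 \<le> d \<Longrightarrow> 0 < R \<Longrightarrow> norm_n d w \<le> \<eta> \<Longrightarrow>
      \<bar>b\<bar> \<le> R * \<eta> \<Longrightarrow> (\<lambda>x\<in>ball_n d R. inner_n d w x + b) \<in> F1_ball \<alpha> d R (c * R * \<eta>)"
    using affine_in_F1_ball[OF assms] by metis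
  \<comment> \<open>The first term comes from \<delta> = c R \<eta> in the complexity bound, the 2
    from the net.\<close>
  define C where "C = 8 * sqrt 2 * ridge_lip \<alpha> * c + 2"
  show ?thesis
  proof (rule exI[of _ c], rule exI[of _ C], intro conjI allI impI ballI)
    show "0 < c"
      by (rule c)
    show "0 < C"
      using c by (simp add: C_def ridge_lip_nonneg add_nonneg_pos)
    fix d n :: nat and R \<eta> G \<delta> :: real and N :: "'y measure"
      and D :: "((nat \<Rightarrow> real) \<times> 'y) measure" and loss :: "'y \<Rightarrow> real \<Rightarrow> real"
      and fhat :: "(nat \<Rightarrow> (nat \<Rightarrow> real) \<times> 'y) \<Rightarrow> (nat \<Rightarrow> real) \<Rightarrow> real"
      and w :: "nat \<Rightarrow> real" and b :: real
    assume d: "1 \<le> d" and n: "1 \<le> n" and R: "0 < R" and \<eta>: "0 < \<eta>" and G: "0 < G"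
      and \<delta>: "\<delta> = c * R * \<eta>"
      and D: "prob_space D" and sets: "sets D = sets (euclid d \<Otimes>\<^sub>M N)"
      and loss: "(\<lambda>(y, u). loss y u) \<in> borel_measurable (N \<Otimes>\<^sub>M borel)"
      and norm: "AE p in D. norm_n d (fst p) \<le> R"
      and L: "assumption_L \<alpha> N D loss G \<delta>"
      and fhat: "AE s in (\<Pi>\<^sub>M i\<in>{..<n}. D). empirical_minimizer n s loss (F1_ball \<alpha> d R \<delta>) (fhat s)"
      and ms: "(\<lambda>s. risk D loss (fhat s)) \<in> borel_measurable (\<Pi>\<^sub>M i\<in>{..<n}. D)"
      and w: "norm_n d w \<le> \<eta>" and b: "\<bar>b\<bar> \<le> R * \<eta>"
    \<comment> \<open>Elements of the variation ball are extensional, so the affine function is cut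
      off outside the ball; inputs lie in the ball almost surely, so its risk is unchanged.\<close>
    define g where "g = (\<lambda>x\<in>ball_n d R. inner_n d w x + b)"
    have g: "g \<in> F1_ball \<alpha> d R \<delta>"
      unfolding g_def \<delta> by (rule affine[OF d R w b])
    have lip: "G-lipschitz_on {u. \<bar>u\<bar> \<le> sqrt 2 ^ \<alpha> * \<delta>} (loss y)" if "y \<in> space N" for y
      using L that by (simp add: assumption_L_def)
    have "risk D loss (\<lambda>x. inner_n d w x + b) = risk D loss g"
      unfolding risk_def
    proof (rule integral_cong_AE)
      show "AE p in D. loss (snd p) (inner_n d w (fst p) + b) = loss (snd p) (g (fst p))"
        using norm AE_space
        by eventually_elim (simp add: g_def ball_n_def sample_space(1)[OF sets])
      show "(\<lambda>p. loss (snd p) (inner_n d w (fst p) + b)) \<in> borel_measurable D"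
        unfolding inner_n_def
        by (intro loss_measurable[OF sets loss, of "\<lambda>x. (\<Sum>i<d. w i * x i) + b"] borel_measurable_add
            borel_measurable_sum borel_measurable_times borel_measurable_const euclid_component) auto
      show "(\<lambda>p. loss (snd p) (g (fst p))) \<in> borel_measurable D"
        using g by (intro loss_measurable[OF sets loss]) (auto simp: F1_ball_def intro: F1_measurable)
    qed
    \<comment> \<open>The net radius is R \<eta> / sqrt n, which gives the net error the order of
      the main term.\<close>
    moreover have "(\<integral>s. risk D loss (fhat s) \<partial>(\<Pi>\<^sub>M i\<in>{..<n}. D)) - risk D loss g \<le>
        8 * sqrt 2 * ridge_lip \<alpha> * G * \<delta> / sqrt n + 2 * G * (R * \<eta> / sqrt n)"
      using assms n R G \<eta> c
      by (intro excess_risk_bound[OF _ _ _ _ _ _ D sets loss norm lip fhat ms g]) (auto simp: \<delta>)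
    moreover have "8 * sqrt 2 * ridge_lip \<alpha> * G * \<delta> / sqrt n + 2 * G * (R * \<eta> / sqrt n) =
        C * (G * R * \<eta> / sqrt n)"
      by (simp add: C_def \<delta> algebra_simps)
    ultimately show "(\<integral>s. risk D loss (fhat s) \<partial>(\<Pi>\<^sub>M i\<in>{..<n}. D)) -
        risk D loss (\<lambda>x. inner_n d w x + b) \<le> C * (G * R * \<eta> / sqrt (real n))"
      by simp
  qed
qed


end
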